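(* Let $N\to\infty$, let $M=M(N)$ with $M\le2\sqrt N$, and let $$\mathcal{G}(N;M)=\{(\lambda,\lambda')\in\mathbb{Z}^2\times\mathbb{Z}^2:\ \|\lambda\|^2=\|\lambda'\|^2\le N,\ 0<\|\lambda-\lambda'\|<M\}.$$ Then $$\#\mathcal{G}(N;M)=4\cdot I\!\left(\frac{M^2}{4N}\right)\sqrt N\,M\log M\left(1+O\left(\frac{1}{\log M}\right)\right),$$ which is an asymptotic as long as $M\to\infty$.
   Context: For $c\in[0,1]$ define $I(c)=\frac{4}{\pi}\int_0^1(1-ct^2)^{1/2}dt$. *)

theory Defs
  imports "HOL-Analysis.Analysis" "HOL-Library.Landau_Symbols"
begin

definition I_fun :: "real \<Rightarrow> real" where
  "I_fun c = 4 / pi * integral {0..1} (\<lambda>t. sqrt (1 - c * t\<^sup>2))"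

text \<open>The norm on \<^typ>\<open>real \<times> real\<close> is the Euclidean one.\<close>

definition lattice_norm :: "int \<times> int \<Rightarrow> real" where
  "lattice_norm v = norm (real_of_int (fst v), real_of_int (snd v))"

definition close_pairs :: "real \<Rightarrow> real \<Rightarrow> ((int \<times> int) \<times> (int \<times> int)) set" where
  "close_pairs N M =
    {(v, w). (lattice_norm v)\<^sup>2 = (lattice_norm w)\<^sup>2 \<and> (lattice_norm w)\<^sup>2 \<le> N \<and>
             0 < lattice_norm (v - w) \<and> lattice_norm (v - w) < M}"

definition main_term :: "real \<Rightarrow> real \<Rightarrow> real" where
  "main_term N M = 4 * I_fun (M\<^sup>2 / (4 * N)) * sqrt N * M * ln M"

end

theory Submission
  imports Defs "HOL-Number_Theory.Totient"
begin

text \<open>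
  Sort the pairs \<open>(v, w)\<close> by the difference \<open>u = v - w = g p\<close> with \<open>p\<close> primitive. The condition
  \<open>\<parallel>v\<parallel> = \<parallel>w\<parallel>\<close> puts \<open>w\<close> on a line orthogonal to \<open>p\<close> at distance \<open>\<parallel>u\<parallel> / 2\<close> from the origin, whose
  lattice points (there are none if \<open>u\<close> has odd coordinate sum) have spacing \<open>\<parallel>p\<parallel> = \<parallel>u\<parallel> / g\<close>. So \<open>u\<close>
  contributes \<open>g \<surd>(4 N - \<parallel>u\<parallel>\<^sup>2) / \<parallel>u\<parallel> + O(1)\<close>, and the \<open>O(1)\<close> terms add up to \<open>O(M\<^sup>2) = O(\<surd>N M)\<close>.
  Expanding \<open>g = (\<Sum>d dvd g. \<phi>(d))\<close> and writing \<open>u = d u'\<close>, the sum over \<open>u'\<close> runs over all of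
  \<open>\<int>\<^sup>2\<close> for even \<open>d\<close> and over the checkerboard lattice for odd \<open>d\<close>; it is compared with an integral by
  partial summation from the trivial bound in the Gauss circle problem. This leaves
  \<open>4 \<pi> \<surd>N M (\<integral>\<^sub>0\<^sup>1 \<surd>(1 - c t\<^sup>2) dt) (\<Sum>d\<le>M. \<omega>(d) \<phi>(d) / d\<^sup>2)\<close> with \<open>\<omega>(d) = 1\<close> for even and \<open>1/2\<close> for
  odd \<open>d\<close>, and the last sum is \<open>4/\<pi>\<^sup>2 ln M + O(1)\<close>.
\<close>

section \<open>Summatory functions of the totient\<close>

definition totient_sum :: "nat \<Rightarrow> real" where
  "totient_sum n = (\<Sum>d=1..n. real (totient d) / real d ^ 2)"

text \<open>This is the density in \<open>\<int>\<^sup>2\<close> of the vectors u' for which d u'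
  has even coordinate sum.\<close>

definition parity_weight :: "nat \<Rightarrow> real" where
  "parity_weight d = (if even d then 1 else 1 / 2)"

definition weighted_totient_sum :: "nat \<Rightarrow> real" where
  "weighted_totient_sum n = (\<Sum>d=1..n. parity_weight d * real (totient d) / real d ^ 2)"

text \<open>Write 1 / k as the sum of phi(d) over the divisors d of k, divided by k^2, and sort the
  pairs (k, d) by the cofactor m = k / d. The known size of \<open>harm n\<close> thus becomes an
  averaged relation for \<open>totient_sum\<close>.\<close>

lemma sum_totient_sum_div:
  "(\<Sum>m=1..n. totient_sum (n div m) / real m ^ 2) = harm n"
proof -
  have "harm n = (\<Sum>k=1..n. real (\<Sum>d | d dvd k. totient d) / real k ^ 2)"
    unfolding harm_def totient_divisor_sum
    by (intro sum.cong) (auto simp: field_simps power2_eq_square)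
  also have "\<dots> = (\<Sum>k=1..n. \<Sum>d | d dvd k. real (totient d) / real k ^ 2)"
    by (simp add: sum_divide_distrib)
  also have "\<dots> = (\<Sum>(k,d)\<in>(SIGMA k:{1..n}. {d. d dvd k}). real (totient d) / real k ^ 2)"
    by (subst sum.Sigma) (auto intro: finite_divisors_nat)
  also have "\<dots> = (\<Sum>(m,d)\<in>(SIGMA m:{1..n}. {1..n div m}). real (totient d) / real (m * d) ^ 2)"
  proof (intro sum.reindex_bij_witness[of _ "\<lambda>(m,d). (m * d, d)" "\<lambda>(k,d). (k div d, d)"], goal_cases)
    case (2 a)
    then show ?case
      by (auto simp: dvd_def Suc_le_eq less_eq_div_iff_mult_less_eq)
        (metis le_trans mult_le_mono1 nat_mult_1 Suc_leI One_nat_def)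
  next
    case (4 b)
    then show ?case
      by (auto simp: less_eq_div_iff_mult_less_eq mult.commute)
  qed (auto simp: dvd_def)
  also have "\<dots> = (\<Sum>m=1..n. \<Sum>d=1..n div m. real (totient d) / real (m * d) ^ 2)"
    by (subst sum.Sigma) auto
  also have "\<dots> = (\<Sum>m=1..n. totient_sum (n div m) / real m ^ 2)"
    unfolding totient_sum_def by (simp add: sum_divide_distrib power_mult_distrib mult.commute)
  finally show ?thesis ..
qed

text \<open>Split the weight into 1/2 for all d and another 1/2 for even d. For d = 2 k one has
  phi(2 k) = 2 phi(k) or phi(k) according as k is even or odd, so the even part reproduces the
  weighted sum up to n / 2.\<close>

lemma weighted_totient_sum_rec:
  "weighted_totient_sum n = totient_sum n / 2 + weighted_totient_sum (n div 2) / 4"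
proof -
  have "(\<Sum>d=1..n. if even d then real (totient d) / real d ^ 2 else 0)
      = (\<Sum>d\<in>{d\<in>{1..n}. even d}. real (totient d) / real d ^ 2)"
    by (subst sum.inter_filter) auto
  also have "\<dots> = (\<Sum>k=1..n div 2. real (totient (2 * k)) / real (2 * k) ^ 2)"
    by (rule sum.reindex_bij_witness[of _ "\<lambda>k. 2 * k" "\<lambda>d. d div 2"]) auto
  also have "\<dots> = weighted_totient_sum (n div 2) / 2"
    unfolding weighted_totient_sum_def sum_divide_distrib
    by (intro sum.cong) (auto simp: totient_double parity_weight_def)
  finally have *: "(\<Sum>d=1..n. if even d then real (totient d) / real d ^ 2 else 0)
      = weighted_totient_sum (n div 2) / 2" .
  have "weighted_totient_sum n = (\<Sum>d=1..n. real (totient d) / real d ^ 2 / 2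
      + (if even d then real (totient d) / real d ^ 2 else 0) / 2)"
    unfolding weighted_totient_sum_def by (intro sum.cong) (auto simp: parity_weight_def)
  also have "\<dots> = totient_sum n / 2 + (weighted_totient_sum (n div 2) / 2) / 2"
    unfolding sum.distrib * [symmetric] totient_sum_def by (simp only: sum_divide_distrib)
  finally show ?thesis by simp
qed

section \<open>Elementary estimates for inverse squares, logarithms and harmonic numbers\<close>

lemma sum_inverse_squares_segment_le:
  assumes "1 \<le> n" "n \<le> k"
  shows "(\<Sum>m=1..k. 1 / real m ^ 2) \<le> (\<Sum>m=1..n. 1 / real m ^ 2) + 1 / n - 1 / k"
  using assms(2)
proof (induction k rule: dec_induct)
  case (step k)
  have "1 / real (Suc k) ^ 2 \<le> 1 / real k - 1 / real (Suc k)"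
    using step assms by (simp add: divide_simps power2_eq_square)
  then show ?case using step.IH by simp
qed simp

text \<open>Two exact terms give 5/4, and telescoping bounds the rest by 1/2. What counts is a bound
  below 2: the terms from m = 2 on must add up to less than 1 in the induction for
  \<open>totient_sum\<close>.\<close>

lemma sum_inverse_squares_le:
  "(\<Sum>m=1..n. 1 / real m ^ 2) \<le> 7 / 4"
proof (cases "n \<ge> 2")
  case True
  have "{1..2::nat} = {1,2}" by auto
  then have "(\<Sum>m=1..2. 1 / real m ^ 2) = 5 / 4" by simp
  moreover have "1 / real n \<ge> 0" by simp
  ultimately show ?thesis using sum_inverse_squares_segment_le[of 2 n] True by linarith
next
  case False
  then have "n = 0 \<or> n = 1" by auto
  then show ?thesis by auto
qed

lemma inverse_squares_tail:
  assumes "n \<ge> 1"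
  shows "\<bar>pi\<^sup>2 / 6 - (\<Sum>m=1..n. 1 / real m ^ 2)\<bar> \<le> 1 / n"
proof -
  have eq: "(\<Sum>m<k. 1 / real ((m + 1)\<^sup>2)) = (\<Sum>m=1..k. 1 / real m ^ 2)" for k
    by (rule sum.reindex_bij_witness[of _ "\<lambda>m. m - 1" Suc]) auto
  have lim: "(\<lambda>k. \<Sum>m=1..k. 1 / real m ^ 2) \<longlonglongrightarrow> pi\<^sup>2 / 6"
    using inverse_squares_sums unfolding sums_def eq .
  have "pi\<^sup>2 / 6 \<le> (\<Sum>m=1..n. 1 / real m ^ 2) + 1 / n"
  proof (rule LIMSEQ_le_const2[OF lim], intro exI[of _ n] allI impI)
    fix k assume "n \<le> k"
    moreover have "1 / real k \<ge> 0" by simp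
    ultimately show "(\<Sum>m=1..k. 1 / real m ^ 2) \<le> (\<Sum>m=1..n. 1 / real m ^ 2) + 1 / n"
      using sum_inverse_squares_segment_le[OF assms, of k] by linarith
  qed
  moreover have "(\<Sum>m=1..n. 1 / real m ^ 2) \<le> pi\<^sup>2 / 6"
  proof (rule LIMSEQ_le_const[OF lim], intro exI[of _ n] allI impI)
    fix k assume "n \<le> k"
    then show "(\<Sum>m=1..n. 1 / real m ^ 2) \<le> (\<Sum>m=1..k. 1 / real m ^ 2)"
      by (intro sum_mono2) auto
  qed
  ultimately show ?thesis by linarith
qed

text \<open>Since n div m >= 1, rounding n / m down loses at most a factor 2, and ln 2 < 1.\<close>

lemma ln_div_nat:
  assumes "1 \<le> m" "m \<le> n"
  shows "\<bar>ln (real (n div m)) - (ln (real n) - ln (real m))\<bar> \<le> 1"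
proof -
  have k: "n div m \<ge> 1" using assms by (simp add: Suc_le_eq div_greater_zero_iff)
  have 1: "real (n div m) \<le> real n / real m" by (simp add: of_nat_div_le_of_nat)
  have "n < (n div m + 1) * m" using assms
    by (simp add: dividend_less_div_times)
  then have "real n < (real (n div m) + 1) * real m"
    by (metis of_nat_1 of_nat_add of_nat_less_iff of_nat_mult)
  then have "real n / real m < real (n div m) + 1"
    using assms by (simp add: pos_divide_less_eq)
  moreover have "real (n div m) \<ge> 1" using k by linarith
  ultimately have 2: "real n / real m \<le> 2 * real (n div m)" by linarith
  have "ln (real (n div m)) \<le> ln (real n / real m)"
    using 1 k assms by (intro ln_mono) auto
  moreover have "ln (real n / real m) \<le> ln (2 * real (n div m))"
    using 2 k assms by (intro ln_mono) auto
  moreover have "ln (2 * real (n div m)) = ln 2 + ln (real (n div m))"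
    using k by (subst ln_mult) auto
  moreover have "ln (real n / real m) = ln (real n) - ln (real m)"
    using assms by (subst ln_div) auto
  ultimately show ?thesis using ln_2_less_1 by linarith
qed

lemma harm_le_one_plus_ln:
  assumes "n \<ge> 1"
  shows "harm n \<le> 1 + ln (real n)"
  using assms
proof (induction n rule: dec_induct)
  case (step n)
  have "ln (real n / real (Suc n)) \<le> real n / real (Suc n) - 1"
    using step by (intro ln_le_minus_one) auto
  moreover have "ln (real n / real (Suc n)) = ln (real n) - ln (real (Suc n))"
    using step by (subst ln_div) auto
  moreover have "real n / real (Suc n) - 1 = - inverse (real (Suc n))" by (simp add: field_simps)
  ultimately show ?case using step.IH by (simp add: harm_Suc)
qed (simp add: harm_expand)

text \<open>From ln x <= x at x = sqrt m, the terms are at most 2 m^(-3/2), which is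
  summable.\<close>

lemma sum_ln_over_squares_bounded: "\<exists>B. \<forall>n. (\<Sum>m=1..n. ln (real m) / real m ^ 2) \<le> B"
proof -
  have s: "summable (\<lambda>m. real m powr (- (3 / 2)))"
    by (subst summable_real_powr_iff) simp
  have "(\<Sum>m=1..n. ln (real m) / real m ^ 2) \<le> 2 * (\<Sum>m. real m powr (- (3 / 2)))" for n
  proof -
    have "ln (real m) / real m ^ 2 \<le> 2 * real m powr (- (3 / 2))" if "m \<ge> 1" for m
    proof -
      have "ln (real m powr (1 / 2)) \<le> real m powr (1 / 2)" using that
        by (intro order.trans[OF ln_le_minus_one]) auto
      then have "ln (real m) \<le> 2 * real m powr (1 / 2)" using that by (simp add: ln_powr)
      then have "ln (real m) / real m ^ 2 \<le> 2 * real m powr (1 / 2) / real m powr 2"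
        using that by (simp add: divide_right_mono powr_numeral)
      also have "\<dots> = 2 * real m powr (- (3 / 2))"
        using that by (simp flip: powr_diff times_divide_eq_right del: powr_numeral)
      finally show ?thesis .
    qed
    then have "(\<Sum>m=1..n. ln (real m) / real m ^ 2) \<le> (\<Sum>m=1..n. 2 * real m powr (- (3 / 2)))"
      by (intro sum_mono) auto
    also have "\<dots> \<le> 2 * (\<Sum>m. real m powr (- (3 / 2)))"
      unfolding sum_distrib_left[symmetric] using s by (intro mult_left_mono sum_le_suminf) auto
    finally show ?thesis .
  qed
  then show ?thesis by blast
qed

text \<open>The error \<open>e\<close> of the expected asymptotics satisfies \<open>(\<Sum>m\<le>n. e (n div m) / m\<^sup>2) = O(1)\<close>; since
  \<open>(\<Sum>m\<ge>2. 1 / m\<^sup>2) \<le> 3 / 4 < 1\<close>, the term \<open>m = 1\<close> dominates, so that induction bounds \<open>e\<close>.\<close>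

lemma totient_sum_asymptotics:
  "\<exists>B. \<forall>n\<ge>1. \<bar>totient_sum n - 6 / pi\<^sup>2 * ln (real n)\<bar> \<le> B"
proof -
  define \<alpha> where "\<alpha> = 6 / pi\<^sup>2"
  define e where "e n = totient_sum n - \<alpha> * ln (real n)" for n
  have \<alpha>: "\<alpha> > 0" "\<alpha> * (pi\<^sup>2 / 6) = 1" by (auto simp: \<alpha>_def)
  obtain B0 where B0: "\<And>n. (\<Sum>m=1..n. ln (real m) / real m ^ 2) \<le> B0"
    using sum_ln_over_squares_bounded by blast
  \<comment> \<open>The leading 1 compares \<open>harm n\<close> with ln n. In 3 + B0, rounding n /
    m costs 2, truncating zeta(2) costs 1, and the terms ln m / m^2 cost B0.\<close>
  define B where "B = 1 + \<alpha> * (3 + B0)"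
  have main: "\<bar>\<Sum>m=1..n. e (n div m) / real m ^ 2\<bar> \<le> B" if n: "n \<ge> 1" for n
  proof -
    define Z where "Z = (\<Sum>m=1..n. 1 / real m ^ 2)"
    define L where "L = (\<Sum>m=1..n. ln (real m) / real m ^ 2)"
    define r where "r m = ln (real (n div m)) - (ln (real n) - ln (real m))" for m
    have "\<bar>\<Sum>m=1..n. r m / real m ^ 2\<bar> \<le> (\<Sum>m=1..n. \<bar>r m / real m ^ 2\<bar>)" by (rule sum_abs)
    also have "\<dots> \<le> Z" unfolding Z_def r_def
      by (intro sum_mono) (auto simp: abs_divide intro!: divide_right_mono ln_div_nat)
    also have "\<dots> \<le> 2"
      using sum_inverse_squares_le[of n] unfolding Z_def by linarith
    finally have R: "\<bar>\<Sum>m=1..n. r m / real m ^ 2\<bar> \<le> 2" .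
    have L: "0 \<le> L" "L \<le> B0" using B0 by (auto simp: L_def intro!: sum_nonneg)
    have "(\<Sum>m=1..n. ln (real (n div m)) / real m ^ 2)
        = (\<Sum>m=1..n. ln (real n) * (1 / real m ^ 2) - ln (real m) / real m ^ 2 + r m / real m ^ 2)"
      by (intro sum.cong) (auto simp: r_def field_simps)
    also have "\<dots> = ln (real n) * Z - L + (\<Sum>m=1..n. r m / real m ^ 2)"
      unfolding sum.distrib sum_subtractf Z_def L_def by (simp only: sum_distrib_left)
    finally have 1: "(\<Sum>m=1..n. ln (real (n div m)) / real m ^ 2)
      = ln (real n) * Z - L + (\<Sum>m=1..n. r m / real m ^ 2)" .
    have "\<bar>pi\<^sup>2 / 6 - Z\<bar> \<le> 1 / n" unfolding Z_def by (rule inverse_squares_tail[OF n])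
    then have "\<bar>ln (real n) * (pi\<^sup>2 / 6 - Z)\<bar> \<le> ln (real n) * (1 / n)"
      using n by (simp add: abs_mult mult_left_mono del: mult_1_right times_divide_eq_right)
    also have "\<dots> \<le> 1"
    proof -
      have "ln (real n) \<le> n" using ln_le_minus_one[of "real n"] n by simp
      then show ?thesis using n by (simp add: field_simps)
    qed
    finally have 2: "\<bar>ln (real n) * (pi\<^sup>2 / 6) - ln (real n) * Z\<bar> \<le> 1" by (simp only: right_diff_distrib)
    have 3: "\<bar>ln (real n) * (pi\<^sup>2 / 6) - (\<Sum>m=1..n. ln (real (n div m)) / real m ^ 2)\<bar> \<le> 3 + B0"
      using 1 2 R L by linarith
    have "\<bar>ln (real n) - \<alpha> * (\<Sum>m=1..n. ln (real (n div m)) / real m ^ 2)\<bar> \<le> \<alpha> * (3 + B0)"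
    proof -
      have "\<alpha> * \<bar>ln (real n) * (pi\<^sup>2 / 6) - (\<Sum>m=1..n. ln (real (n div m)) / real m ^ 2)\<bar> \<le> \<alpha> * (3 + B0)"
        using 3 \<alpha> by (intro mult_left_mono) auto
      moreover have "\<alpha> * \<bar>ln (real n) * (pi\<^sup>2 / 6) - (\<Sum>m=1..n. ln (real (n div m)) / real m ^ 2)\<bar>
         = \<bar>ln (real n) * (\<alpha> * (pi\<^sup>2 / 6)) - \<alpha> * (\<Sum>m=1..n. ln (real (n div m)) / real m ^ 2)\<bar>"
        using \<alpha>(1) by (subst abs_of_pos[symmetric, of \<alpha>], simp, subst abs_mult[symmetric], simp add: algebra_simps)
      ultimately show ?thesis using \<alpha>(2) by simp
    qed
    moreover have "(\<Sum>m=1..n. e (n div m) / real m ^ 2)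
        = harm n - \<alpha> * (\<Sum>m=1..n. ln (real (n div m)) / real m ^ 2)"
      unfolding sum_totient_sum_div[symmetric] e_def
      by (simp add: sum_distrib_left diff_divide_distrib sum_subtractf)
    moreover have "\<bar>harm n - ln (real n)\<bar> \<le> 1"
      using harm_le_one_plus_ln[OF n] euler_mascheroni_sequence_nonneg[of n] n by simp
    ultimately show ?thesis unfolding B_def by linarith
  qed
  \<comment> \<open>4 B is the fixed point of the inductive estimate: B + (3/4) (4 B) = 4 B.\<close>
  have "\<bar>e n\<bar> \<le> 4 * B" if "n \<ge> 1" for n
    using that
  proof (induction n rule: less_induct)
    case (less n)
    have B: "B \<ge> 0" using main[of 1] by linarith
    have split: "{1..n} = insert 1 {2..n}" using less.prems by auto
    have "\<bar>\<Sum>m=2..n. e (n div m) / real m ^ 2\<bar> \<le> (\<Sum>m=2..n. \<bar>e (n div m) / real m ^ 2\<bar>)"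
      by (rule sum_abs)
    also have "\<dots> \<le> (\<Sum>m=2..n. 4 * B * (1 / real m ^ 2))"
    proof (intro sum_mono)
      fix m assume m: "m \<in> {2..n}"
      then have "n div m < n" "n div m \<ge> 1" using less.prems by (auto simp: Suc_le_eq div_greater_zero_iff)
      then have "\<bar>e (n div m)\<bar> \<le> 4 * B" using less.IH by blast
      then show "\<bar>e (n div m) / real m ^ 2\<bar> \<le> 4 * B * (1 / real m ^ 2)"
        by (simp add: abs_divide divide_right_mono)
    qed
    also have "\<dots> = 4 * B * (\<Sum>m=2..n. 1 / real m ^ 2)" by (simp only: sum_distrib_left)
    also have "(\<Sum>m=2..n. 1 / real m ^ 2) \<le> 3 / 4"
    proof -
      have "(\<Sum>m=1..n. 1 / real m ^ 2) = 1 + (\<Sum>m=2..n. 1 / real m ^ 2)"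
        unfolding split by simp
      then show ?thesis using sum_inverse_squares_le[of n] by linarith
    qed
    finally have "\<bar>\<Sum>m=2..n. e (n div m) / real m ^ 2\<bar> \<le> 3 * B" using B by (simp add: mult_left_mono)
    moreover have "(\<Sum>m=1..n. e (n div m) / real m ^ 2) = e n + (\<Sum>m=2..n. e (n div m) / real m ^ 2)"
      unfolding split by simp
    ultimately show ?case using main[OF less.prems] by linarith
  qed
  then show ?thesis unfolding e_def \<alpha>_def by blast
qed

text \<open>By the recursion the coefficient \<open>\<beta>\<close> of ln n must satisfy
  \<open>\<beta>\<close> = 3 / pi^2 + \<open>\<beta>\<close> / 4, hence \<open>\<beta>\<close> = 4 /
  pi^2. The error is multiplied by 1/4 at each halving of n, so it stays bounded.\<close>

lemma weighted_totient_sum_asymptotics: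
  "\<exists>B. \<forall>n\<ge>1. \<bar>weighted_totient_sum n - 4 / pi\<^sup>2 * ln (real n)\<bar> \<le> B"
proof -
  obtain B where B: "\<And>n. n \<ge> 1 \<Longrightarrow> \<bar>totient_sum n - 6 / pi\<^sup>2 * ln (real n)\<bar> \<le> B"
    using totient_sum_asymptotics by blast
  define \<beta> where "\<beta> = 4 / pi\<^sup>2"
  have \<beta>: "\<beta> > 0" "6 / pi\<^sup>2 = 3 / 2 * \<beta>" by (auto simp: \<beta>_def)
  \<comment> \<open>The value at n = 1 is 1/2, and the inductive step requires B / 2 + (K + 2
    \<open>\<beta>\<close>) / 4 <= K.\<close>
  define K where "K = 1 / 2 + 2 * B + 2 * \<beta>"
  have B0: "B \<ge> 0" using B[of 1] by linarith
  have "\<bar>weighted_totient_sum n - \<beta> * ln (real n)\<bar> \<le> K" if "n \<ge> 1" for n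
    using that
  proof (induction n rule: less_induct)
    case (less n)
    show ?case
    proof (cases "n = 1")
      case True
      then show ?thesis using B0 \<beta> by (simp add: weighted_totient_sum_def parity_weight_def K_def)
    next
      case False
      then have n: "2 \<le> n" "1 \<le> n div 2" "n div 2 < n" using less.prems by auto
      have 1: "\<bar>weighted_totient_sum (n div 2) - \<beta> * ln (real (n div 2))\<bar> \<le> K"
        using less.IH n by blast
      have "\<bar>ln (real (n div 2)) - ln (real n)\<bar> \<le> 2"
        using ln_div_nat[of 2 n] n ln_2_less_1 by (auto simp: abs_le_iff)
      then have "\<bar>\<beta> * ln (real (n div 2)) - \<beta> * ln (real n)\<bar> \<le> \<beta> * 2"
        using \<beta>(1) by (simp flip: right_diff_distrib add: abs_mult)
      then show ?thesis
        using 1 B[OF less.prems] B0 \<beta> weighted_totient_sum_rec[of n] unfolding K_def by (simp add: abs_le_iff)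
    qed
  qed
  then show ?thesis unfolding \<beta>_def by blast
qed

section \<open>Lattice points in discs\<close>

text \<open>Natural values allow radial lattice sums to be sorted by the squared norm n = 1, 2,
  ...\<close>

definition normsq :: "int \<times> int \<Rightarrow> nat" where
  "normsq u = nat ((fst u)\<^sup>2 + (snd u)\<^sup>2)"

lemma int_normsq: "int (normsq u) = (fst u)\<^sup>2 + (snd u)\<^sup>2"
  by (simp add: normsq_def)

lemma real_normsq: "real (normsq u) = (real_of_int (fst u))\<^sup>2 + (real_of_int (snd u))\<^sup>2"
  by (metis int_normsq of_int_add of_int_of_nat_eq of_int_power)

lemma normsq_eq_0_iff: "normsq u = 0 \<longleftrightarrow> u = 0"
proof -
  have "normsq u = 0 \<longleftrightarrow> (fst u)\<^sup>2 + (snd u)\<^sup>2 = 0"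
    unfolding int_normsq[symmetric] by simp
  then show ?thesis by (simp add: prod_eq_iff)
qed

lemma abs_coords_le_normsq:
  assumes "real (normsq u) \<le> r\<^sup>2" "0 \<le> r"
  shows "\<bar>fst u\<bar> \<le> \<lfloor>r\<rfloor>" "\<bar>snd u\<bar> \<le> \<lfloor>r\<rfloor>"
proof -
  have "(real_of_int (fst u))\<^sup>2 \<le> r\<^sup>2" "(real_of_int (snd u))\<^sup>2 \<le> r\<^sup>2"
    using assms unfolding real_normsq by (smt (verit) zero_le_power2)+
  then have "\<bar>real_of_int (fst u)\<bar> \<le> r" "\<bar>real_of_int (snd u)\<bar> \<le> r"
    using assms by (auto simp: abs_le_square_iff[symmetric])
  then show "\<bar>fst u\<bar> \<le> \<lfloor>r\<rfloor>" "\<bar>snd u\<bar> \<le> \<lfloor>r\<rfloor>"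
    by linarith+
qed

lemma finite_normsq_le_square:
  assumes "0 \<le> r"
  shows "finite {u. real (normsq u) \<le> r\<^sup>2}"
    and "real (card {u. real (normsq u) \<le> r\<^sup>2}) \<le> (2 * r + 1)\<^sup>2"
proof -
  have sub: "{u. real (normsq u) \<le> r\<^sup>2} \<subseteq> {-\<lfloor>r\<rfloor>..\<lfloor>r\<rfloor>} \<times> {-\<lfloor>r\<rfloor>..\<lfloor>r\<rfloor>}"
  proof
    fix u assume "u \<in> {u. real (normsq u) \<le> r\<^sup>2}"
    then show "u \<in> {-\<lfloor>r\<rfloor>..\<lfloor>r\<rfloor>} \<times> {-\<lfloor>r\<rfloor>..\<lfloor>r\<rfloor>}"
      using abs_coords_le_normsq[of u r] assms by (auto simp: mem_Times_iff abs_le_iff)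
  qed
  show "finite {u. real (normsq u) \<le> r\<^sup>2}"
    by (rule finite_subset[OF sub]) auto
  have "card {u. real (normsq u) \<le> r\<^sup>2} \<le> card ({-\<lfloor>r\<rfloor>..\<lfloor>r\<rfloor>} \<times> {-\<lfloor>r\<rfloor>..\<lfloor>r\<rfloor>})"
    by (rule card_mono[OF _ sub]) auto
  also have "\<dots> = (nat (2 * \<lfloor>r\<rfloor> + 1))\<^sup>2" by (simp add: card_cartesian_product power2_eq_square)
  finally have "real (card {u. real (normsq u) \<le> r\<^sup>2}) \<le> (real (nat (2 * \<lfloor>r\<rfloor> + 1)))\<^sup>2"
    by (metis of_nat_le_iff of_nat_power)
  also have "\<dots> \<le> (2 * r + 1)\<^sup>2" using assms by (intro power_mono) (auto simp: of_nat_nat)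
  finally show "real (card {u. real (normsq u) \<le> r\<^sup>2}) \<le> (2 * r + 1)\<^sup>2" .
qed

lemma finite_normsq_le: "finite {u. normsq u \<le> n}"
  using finite_normsq_le_square(1)[of "sqrt n"] by simp

text \<open>Open cells are pairwise disjoint and serve for the upper bound on the number of lattice
  points; closed cells cover the plane and serve for the lower bound.\<close>

definition open_cell :: "int \<times> int \<Rightarrow> (real \<times> real) set" where
  "open_cell u = box (real_of_int (fst u), real_of_int (snd u))
                        (real_of_int (fst u) + 1, real_of_int (snd u) + 1)"

definition closed_cell :: "int \<times> int \<Rightarrow> (real \<times> real) set" where
  "closed_cell u = cbox (real_of_int (fst u), real_of_int (snd u))
                        (real_of_int (fst u) + 1, real_of_int (snd u) + 1)"

lemma mem_closed_cell:
  "(x, y) \<in> closed_cell u \<longleftrightarrow> of_int (fst u) \<le> x \<and> x \<le> of_int (fst u) + 1 \<and>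
     of_int (snd u) \<le> y \<and> y \<le> of_int (snd u) + 1"
  by (auto simp: closed_cell_def)

lemma mem_open_cell:
  "(x, y) \<in> open_cell u \<longleftrightarrow> of_int (fst u) < x \<and> x < of_int (fst u) + 1 \<and>
     of_int (snd u) < y \<and> y < of_int (snd u) + 1"
  by (auto simp: open_cell_def box_def Basis_prod_def)

lemma measure_closed_cell: "measure lborel (closed_cell u) = 1"
  by (simp add: closed_cell_def content_Pair)

lemma measure_open_cell: "measure lborel (open_cell u) = 1"
  using measure_closed_cell[of u]
  by (simp add: open_cell_def closed_cell_def measure_lborel_box_eq measure_lborel_cbox_eq)

lemma norm_closed_cell:
  assumes "z \<in> closed_cell u"
  shows "norm (z - (real_of_int (fst u), real_of_int (snd u))) \<le> 2"
proof (cases z)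
  case (Pair x y)
  have "norm (x - of_int (fst u), y - of_int (snd u)) \<le> norm (x - of_int (fst u)) + norm (y - of_int (snd u))"
    by (rule norm_Pair_le)
  then show ?thesis using assms unfolding Pair mem_closed_cell by simp
qed

lemma norm_lattice_point:
  "norm (real_of_int (fst u), real_of_int (snd u)) = sqrt (real (normsq u))"
  by (simp add: norm_Pair real_normsq)

lemma content_disc:
  assumes "0 \<le> r"
  shows "measure lborel (cball (0 :: real \<times> real) r) = pi * r\<^sup>2"
  using assms by (simp add: content_cball unit_ball_vol_2 power2_eq_square)

text \<open>Gauss's argument with r = sqrt n: the cells of the points counted lie in the disc of
  radius r + 2 and, for r >= 2, cover the disc of radius r - 2. The areas differ from pi n by at
  most pi (4 r + 4) <= 8 pi r.\<close>

lemma lattice_points_in_disc: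
  assumes n: "n \<ge> 1"
  shows "\<bar>real (card {u. normsq u \<le> n}) - pi * n\<bar> \<le> 8 * pi * sqrt n"
proof -
  define P where "P = {u. normsq u \<le> n}"
  define r where "r = sqrt (real n)"
  have r: "r \<ge> 1" "r\<^sup>2 = n" using n by (auto simp: r_def)
  have fin: "finite P" unfolding P_def by (rule finite_normsq_le)
  have P: "u \<in> P \<longleftrightarrow> norm (real_of_int (fst u), real_of_int (snd u)) \<le> r" for u
    unfolding P_def r_def norm_lattice_point by simp
  have disj: "disjoint_family_on open_cell P"
  proof (unfold disjoint_family_on_def, intro ballI impI)
    fix u v :: "int \<times> int" assume "u \<noteq> v"
    show "open_cell u \<inter> open_cell v = {}"
    proof (rule ccontr)
      assume "open_cell u \<inter> open_cell v \<noteq> {}"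
      then obtain x y where "(x, y) \<in> open_cell u" "(x, y) \<in> open_cell v" by auto
      then have "fst u = fst v" "snd u = snd v" unfolding mem_open_cell by linarith+
      with \<open>u \<noteq> v\<close> show False by (simp add: prod_eq_iff)
    qed
  qed
  have finite_cell: "emeasure lborel (open_cell u) \<noteq> \<infinity>" for u
    unfolding open_cell_def by (rule less_imp_neq[OF emeasure_lborel_box_finite])
  have "real (card P) = (\<Sum>u\<in>P. measure lborel (open_cell u))"
    by (simp add: measure_open_cell)
  also have "\<dots> = measure lborel (\<Union>u\<in>P. open_cell u)"
    using fin by (intro measure_finite_Union[symmetric] disj finite_cell) (auto simp: open_cell_def)
  also have "\<dots> \<le> measure lborel (cball (0 :: real \<times> real) (r + 2))"
  proof (rule measure_mono_fmeasurable)
    show "(\<Union>u\<in>P. open_cell u) \<subseteq> cball 0 (r + 2)"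
    proof
      fix z assume "z \<in> (\<Union>u\<in>P. open_cell u)"
      then obtain u where u: "u \<in> P" "z \<in> open_cell u" by blast
      then have "z \<in> closed_cell u"
        by (cases z) (auto simp: mem_open_cell mem_closed_cell)
      then have "norm (z - (real_of_int (fst u), real_of_int (snd u))) \<le> 2" by (rule norm_closed_cell)
      moreover have "norm (real_of_int (fst u), real_of_int (snd u)) \<le> r" using u P by blast
      ultimately have "norm z \<le> r + 2" by norm
      then show "z \<in> cball 0 (r + 2)" by simp
    qed
  qed (use fin in \<open>auto simp: open_cell_def intro!: fmeasurableI emeasure_bounded_finite\<close>)
  also have "\<dots> = pi * (n + 4 * r + 4)" using r by (subst content_disc) (auto simp: power2_sum)
  also have "\<dots> \<le> pi * (n + 8 * r)" using r by (intro mult_left_mono) auto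
  finally have upper: "real (card P) \<le> pi * n + 8 * pi * r" by (simp add: algebra_simps)
  have "pi * n - 8 * pi * r \<le> real (card P)"
  proof (cases "r \<ge> 2")
    case True
    have "pi * n - 8 * pi * r \<le> pi * (r - 2)\<^sup>2"
    proof -
      have "pi * (n - 8 * r) \<le> pi * (r - 2)\<^sup>2"
        using r by (intro mult_left_mono) (auto simp: power2_diff)
      then show ?thesis by (simp add: algebra_simps)
    qed
    also have "\<dots> = measure lborel (cball (0 :: real \<times> real) (r - 2))"
      using True by (subst content_disc) auto
    also have "\<dots> \<le> measure lborel (\<Union>u\<in>P. closed_cell u)"
    proof (rule measure_mono_fmeasurable)
      show "cball 0 (r - 2) \<subseteq> (\<Union>u\<in>P. closed_cell u)"
      proof
        fix z :: "real \<times> real" assume z: "z \<in> cball 0 (r - 2)"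
        define u where "u = (\<lfloor>fst z\<rfloor>, \<lfloor>snd z\<rfloor>)"
        have zu: "z \<in> closed_cell u"
          by (cases z) (auto simp: mem_closed_cell u_def)
        then have "norm (z - (real_of_int (fst u), real_of_int (snd u))) \<le> 2" by (rule norm_closed_cell)
        moreover have "norm z \<le> r - 2" using z by simp
        ultimately have "norm (real_of_int (fst u), real_of_int (snd u)) \<le> r" by norm
        then show "z \<in> (\<Union>u\<in>P. closed_cell u)" using zu P by blast
      qed
      show "(\<Union>u\<in>P. closed_cell u) \<in> fmeasurable lborel"
        using fin by (intro fmeasurable.finite_UN) (auto simp: closed_cell_def fmeasurable_cbox)
    qed auto
    also have "\<dots> \<le> (\<Sum>u\<in>P. measure lborel (closed_cell u))"
      using fin by (intro measure_UNION_le) (auto simp: closed_cell_def)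
    also have "\<dots> = real (card P)" by (simp add: measure_closed_cell)
    finally show ?thesis .
  next
    case False
    \<comment> \<open>For r < 2 the lower bound to be shown is not positive, as n = r^2 <= 8
      r.\<close>
    have "real n \<le> 8 * r" using False r by (simp flip: r(2) add: power2_eq_square)
    then have "pi * n \<le> pi * (8 * r)" by (intro mult_left_mono) auto
    then have "pi * n \<le> 8 * pi * r" by (simp only: mult_ac)
    then show ?thesis using of_nat_0_le_iff[of "card P", where 'a = real] by linarith
  qed
  with upper show ?thesis unfolding P_def r_def by (auto simp: abs_le_iff)
qed

section \<open>Partial summation against a decreasing weight\<close>

lemma summation_by_parts:
  fixes f g :: "nat \<Rightarrow> real"
  shows "(\<Sum>n=1..k. f n * g n) = (\<Sum>n=1..k. f n) * g k + (\<Sum>n=1..<k. (\<Sum>i=1..n. f i) * (g n - g (Suc n)))"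
proof (induction k)
  case (Suc k)
  show ?case
  proof (cases "k = 0")
    case False
    then have "{1..<Suc k} = insert k {1..<k}" by auto
    then show ?thesis using Suc.IH by (simp add: algebra_simps)
  qed simp
qed simp

text \<open>K sqrt n is the partial sum of the numbers K (sqrt i - sqrt (i - 1)). Against a
  nonnegative decreasing weight, summation by parts has nonnegative coefficients, so the bound on
  partial sums passes to the weighted sums; a second summation by parts restores the form of a
  sum.\<close>

lemma abel_sqrt_bound:
  fixes e \<Phi> :: "nat \<Rightarrow> real"
  assumes bound: "\<And>n. n \<ge> 1 \<Longrightarrow> \<bar>\<Sum>i=1..n. e i\<bar> \<le> K * sqrt n"
    and anti: "\<And>n. 1 \<le> n \<Longrightarrow> n < k \<Longrightarrow> \<Phi> (Suc n) \<le> \<Phi> n"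
    and nonneg: "\<And>n. 1 \<le> n \<Longrightarrow> n \<le> k \<Longrightarrow> 0 \<le> \<Phi> n"
  shows "\<bar>\<Sum>n=1..k. e n * \<Phi> n\<bar> \<le> K * (\<Sum>n=1..k. (sqrt n - sqrt (real n - 1)) * \<Phi> n)"
proof (cases "k = 0")
  case False
  define E where "E n = (\<Sum>i=1..n. e i)" for n
  have tele: "(\<Sum>i=1..n. sqrt i - sqrt (real i - 1)) = sqrt n" for n :: nat
    by (induction n) auto
  have "\<bar>\<Sum>n=1..k. e n * \<Phi> n\<bar> = \<bar>E k * \<Phi> k + (\<Sum>n=1..<k. E n * (\<Phi> n - \<Phi> (Suc n)))\<bar>"
    unfolding E_def by (rule arg_cong[where f = abs], rule summation_by_parts)
  also have "\<dots> \<le> \<bar>E k * \<Phi> k\<bar> + (\<Sum>n=1..<k. \<bar>E n * (\<Phi> n - \<Phi> (Suc n))\<bar>)"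
    by (intro order.trans[OF abs_triangle_ineq] add_left_mono sum_abs)
  also have "\<dots> \<le> (K * sqrt k) * \<Phi> k + (\<Sum>n=1..<k. (K * sqrt n) * (\<Phi> n - \<Phi> (Suc n)))"
  proof -
    have "K \<ge> 0" using bound[of 1] by simp
    then show ?thesis
      using False bound anti nonneg unfolding E_def
      by (intro add_mono sum_mono) (auto simp: abs_mult intro!: mult_mono)
  qed
  also have "\<dots> = K * (sqrt k * \<Phi> k + (\<Sum>n=1..<k. sqrt n * (\<Phi> n - \<Phi> (Suc n))))"
    by (simp add: distrib_left sum_distrib_left mult.assoc)
  also have "sqrt k * \<Phi> k + (\<Sum>n=1..<k. sqrt n * (\<Phi> n - \<Phi> (Suc n)))
      = (\<Sum>n=1..k. (sqrt n - sqrt (real n - 1)) * \<Phi> n)"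
    by (subst summation_by_parts) (simp only: tele)
  finally show ?thesis .
qed simp

section \<open>Radial lattice sums\<close>

text \<open>At t = 1 this is pi / 4 times \<open>I_fun c\<close>. The variable upper limit lets
  increments telescope when a sum is compared with the integral.\<close>

definition sqrt_integral :: "real \<Rightarrow> real \<Rightarrow> real" where
  "sqrt_integral c t = integral {0..t} (\<lambda>s. sqrt (1 - c * s\<^sup>2))"

lemma sqrt_integrable: "(\<lambda>s. sqrt (1 - c * s\<^sup>2)) integrable_on {a..b}"
  by (intro integrable_continuous_real continuous_intros)

lemma sqrt_integral_0: "sqrt_integral c 0 = 0"
  by (simp add: sqrt_integral_def)

lemma sqrt_integral_diff:
  assumes "0 \<le> a" "a \<le> b"
  shows "sqrt_integral c b - sqrt_integral c a = integral {a..b} (\<lambda>s. sqrt (1 - c * s\<^sup>2))"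
  unfolding sqrt_integral_def
  using Henstock_Kurzweil_Integration.integral_combine[OF assms sqrt_integrable[of c 0 b]] by simp

lemma sqrt_integral_diff_bounds:
  assumes "0 \<le> c" "0 \<le> a" "a \<le> b"
  shows "sqrt (1 - c * b\<^sup>2) * (b - a) \<le> sqrt_integral c b - sqrt_integral c a"
    and "sqrt_integral c b - sqrt_integral c a \<le> sqrt (1 - c * a\<^sup>2) * (b - a)"
proof -
  have "integral {a..b} (\<lambda>s. sqrt (1 - c * b\<^sup>2)) \<le> integral {a..b} (\<lambda>s. sqrt (1 - c * s\<^sup>2))"
    using assms
    by (intro integral_le sqrt_integrable integrable_const_ivl)
      (auto intro!: mult_left_mono power_mono)
  then show "sqrt (1 - c * b\<^sup>2) * (b - a) \<le> sqrt_integral c b - sqrt_integral c a"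
    using assms by (simp add: sqrt_integral_diff mult.commute)
  have "integral {a..b} (\<lambda>s. sqrt (1 - c * s\<^sup>2)) \<le> integral {a..b} (\<lambda>s. sqrt (1 - c * a\<^sup>2))"
    using assms
    by (intro integral_le sqrt_integrable integrable_const_ivl)
      (auto intro!: mult_left_mono power_mono)
  then show "sqrt_integral c b - sqrt_integral c a \<le> sqrt (1 - c * a\<^sup>2) * (b - a)"
    using assms by (simp add: sqrt_integral_diff mult.commute)
qed

text \<open>With a = sqrt n and b = sqrt (n - 1) one has (a - b) (a + b) = 1; the three bounds
  estimate a + b by 2 a, a and 2 b.\<close>

lemma sqrt_diff_bounds:
  assumes "n \<ge> 1"
  shows "1 / sqrt (real n) \<le> 2 * (sqrt n - sqrt (real n - 1))"
    and "sqrt n - sqrt (real n - 1) \<le> 1 / sqrt n"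
    and "n \<ge> 2 \<Longrightarrow> 2 * (sqrt n - sqrt (real n - 1)) \<le> 1 / sqrt (real n - 1)"
proof -
  have n: "real n \<ge> 1" using assms by simp
  define a b where "a = sqrt (real n)" and "b = sqrt (real n - 1)"
  have ab: "a > 0" "b \<ge> 0" "b \<le> a" using n by (auto simp: a_def b_def)
  have "(a - b) * (a + b) = a\<^sup>2 - b\<^sup>2" by (simp add: algebra_simps power2_eq_square)
  then have eq: "(a - b) * (a + b) = 1" using n by (simp add: a_def b_def)
  have "1 \<le> (a - b) * (2 * a)" unfolding eq[symmetric] using ab by (intro mult_left_mono) auto
  then show "1 / sqrt (real n) \<le> 2 * (sqrt n - sqrt (real n - 1))"
    unfolding a_def[symmetric] b_def[symmetric] using ab by (simp add: field_simps)
  have "(a - b) * a \<le> 1" unfolding eq[symmetric] using ab by (intro mult_left_mono) auto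
  then show "sqrt n - sqrt (real n - 1) \<le> 1 / sqrt n"
    unfolding a_def[symmetric] b_def[symmetric] using ab by (simp add: field_simps)
  assume "n \<ge> 2"
  then have "b > 0" by (simp add: b_def)
  have "(a - b) * (2 * b) \<le> 1" unfolding eq[symmetric] using ab by (intro mult_left_mono) auto
  then show "2 * (sqrt n - sqrt (real n - 1)) \<le> 1 / sqrt (real n - 1)"
    unfolding a_def[symmetric] b_def[symmetric] using \<open>b > 0\<close> by (simp add: field_simps)
qed

text \<open>For c = M^2 / (4 N) and y = (M / d)^2, the term sqrt (4 N - |u|^2) / |u| at u = d u'
  equals 2 sqrt N / d times this weight at n = |u'|^2. As c is free of d, all d lead to the same
  integral.\<close>

definition radial_weight :: "real \<Rightarrow> real \<Rightarrow> nat \<Rightarrow> real" where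
  "radial_weight c y n = sqrt (1 - c * n / y) / sqrt n"

text \<open>The weight decreases in n, and x = y t^2 turns its integral over [0, y] into 2 sqrt y
  times \<open>sqrt_integral c 1\<close>. The hypotheses make k the largest natural number strictly
  below y.\<close>

lemma sum_radial_weight:
  assumes c: "0 \<le> c" "c \<le> 1" and k: "real k < y" "y \<le> real k + 1"
  shows "\<bar>(\<Sum>n=1..k. radial_weight c y n) - 2 * sqrt y * sqrt_integral c 1\<bar> \<le> 4"
proof -
  define J where "J = sqrt_integral c"
  have y: "y > 0" using k by linarith
  define t where "t n = sqrt (real n / y)" for n :: nat
  \<comment> \<open>\<open>D n\<close> is the integral of the weight over [n - 1, n], hence lies
    between the weights at n and at n - 1 for n >= 2.\<close>
  define D where "D n = 2 * sqrt y * (J (t n) - J (t (n - 1)))" for n :: nat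
  have t: "0 \<le> t n" "(t n)\<^sup>2 = n / y" "sqrt y * t n = sqrt n" for n
    using y by (auto simp: t_def real_sqrt_divide power_divide)
  have t_mono: "t n \<le> t m" if "n \<le> m" for m n
    using y that by (auto simp: t_def divide_right_mono)
  have tk: "t k \<le> 1" using k y by (auto simp: t_def)
  have w: "radial_weight c y n = sqrt (1 - c * (t n)\<^sup>2) / sqrt n" for n
    by (simp add: radial_weight_def t)
  have g: "0 \<le> 1 - c * x\<^sup>2" if "0 \<le> x" "x \<le> 1" for x
    using c that by (simp add: mult_le_one power_le_one)
  have step: "2 * sqrt y * (t n - t (n - 1)) = 2 * (sqrt n - sqrt (real n - 1))" if "n \<ge> 1" for n
    using t(3)[of n] t(3)[of "n - 1"] that by (simp add: algebra_simps of_nat_diff)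
  have D1: "radial_weight c y n \<le> D n" if "n \<ge> 1" "n \<le> k" for n
  proof -
    have tn: "t n \<le> 1" using t_mono[of n k] tk that by linarith
    have "radial_weight c y n = sqrt (1 - c * (t n)\<^sup>2) * (1 / sqrt n)" by (simp add: w)
    also have "\<dots> \<le> sqrt (1 - c * (t n)\<^sup>2) * (2 * (sqrt n - sqrt (real n - 1)))"
      using g[of "t n"] t tn that by (intro mult_left_mono sqrt_diff_bounds) auto
    also have "\<dots> = 2 * sqrt y * (sqrt (1 - c * (t n)\<^sup>2) * (t n - t (n - 1)))"
      unfolding step[OF that(1), symmetric] by simp
    also have "\<dots> \<le> D n" unfolding D_def J_def using y c t t_mono
      by (intro mult_left_mono sqrt_integral_diff_bounds) auto
    finally show ?thesis .
  qed
  have D2: "D n \<le> radial_weight c y (n - 1)" if "n \<ge> 2" "n \<le> k" for n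
  proof -
    have tn: "t (n - 1) \<le> 1" using t_mono[of "n - 1" k] tk that by linarith
    have "D n \<le> 2 * sqrt y * (sqrt (1 - c * (t (n - 1))\<^sup>2) * (t n - t (n - 1)))"
      unfolding D_def J_def using y c t t_mono
      by (intro mult_left_mono sqrt_integral_diff_bounds) auto
    also have "\<dots> = sqrt (1 - c * (t (n - 1))\<^sup>2) * (2 * (sqrt n - sqrt (real n - 1)))"
      using that by (subst step[symmetric]) auto
    also have "\<dots> \<le> sqrt (1 - c * (t (n - 1))\<^sup>2) * (1 / sqrt (real n - 1))"
      using g[of "t (n - 1)"] t tn that by (intro mult_left_mono sqrt_diff_bounds) auto
    also have "\<dots> = radial_weight c y (n - 1)" using that by (simp add: w of_nat_diff)
    finally show ?thesis .
  qed
  have le1: "J b - J a \<le> b - a" if "0 \<le> a" "a \<le> b" for a b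
  proof -
    have "J b - J a \<le> sqrt (1 - c * a\<^sup>2) * (b - a)"
      unfolding J_def using that c by (intro sqrt_integral_diff_bounds) auto
    also have "\<dots> \<le> 1 * (b - a)" using c that by (intro mult_right_mono) auto
    finally show ?thesis by simp
  qed
  have J0: "J (t 0) = 0" by (simp add: J_def t_def sqrt_integral_0)
  have sumD: "(\<Sum>n=1..m. D n) = 2 * sqrt y * J (t m)" for m
    by (induction m) (auto simp: D_def J0 algebra_simps)
  \<comment> \<open>The sum ends at k but the integral at y <= k + 1; the missing piece costs at
    most 2.\<close>
  have J_end: "0 \<le> J 1 - J (t k)" "2 * sqrt y * (J 1 - J (t k)) \<le> 2"
  proof -
    have "0 \<le> sqrt (1 - c * 1\<^sup>2) * (1 - t k)" using c tk by auto
    also have "\<dots> \<le> J 1 - J (t k)"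
      unfolding J_def using c tk t by (intro sqrt_integral_diff_bounds) auto
    finally show "0 \<le> J 1 - J (t k)" .
    have "2 * sqrt y * (J 1 - J (t k)) \<le> 2 * sqrt y * (1 - t k)"
      using le1[of "t k" 1] t tk y by (intro mult_left_mono) auto
    also have "\<dots> = 2 * sqrt y - 2 * sqrt k" using t(3)[of k] by (simp add: algebra_simps)
    also have "\<dots> \<le> 2 * (sqrt (k + 1) - sqrt k)"
      using k by (simp add: add.commute)
    also have "\<dots> \<le> 2 * (1 / sqrt (k + 1))"
      using sqrt_diff_bounds(2)[of "k + 1"] by simp
    also have "\<dots> \<le> 2" by (simp add: divide_le_eq)
    finally show "2 * sqrt y * (J 1 - J (t k)) \<le> 2" .
  qed
  have "(\<Sum>n=1..k. radial_weight c y n) \<le> 2 * sqrt y * J (t k)"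
    unfolding sumD[symmetric] by (intro sum_mono D1) auto
  also have "\<dots> \<le> 2 * sqrt y * J 1" using J_end(1) y by (intro mult_left_mono) auto
  finally have upper: "(\<Sum>n=1..k. radial_weight c y n) \<le> 2 * sqrt y * J 1" .
  have "2 * sqrt y * J (t k) - 2 \<le> (\<Sum>n=1..k. radial_weight c y n)"
  proof (cases "k = 0")
    case False
    \<comment> \<open>The interval [0, 1] is kept apart because the true weight is singular at 0;
      its integral \<open>D 1\<close> costs another 2.\<close>
    then have "{1..k} = insert 1 {2..k}" by auto
    then have "2 * sqrt y * J (t k) = D 1 + (\<Sum>n=2..k. D n)" unfolding sumD[symmetric] by simp
    also have "D 1 \<le> 2"
    proof -
      have "D 1 \<le> 2 * sqrt y * (t 1 - t 0)"
        unfolding D_def using le1[of "t 0" "t 1"] t_mono[of 0 1] t y by (intro mult_left_mono) auto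
      also have "\<dots> = 2" using step[of 1] by simp
      finally show ?thesis .
    qed
    also have "(\<Sum>n=2..k. D n) \<le> (\<Sum>n=2..k. radial_weight c y (n - 1))"
      by (intro sum_mono D2) auto
    also have "\<dots> = (\<Sum>n=1..k - 1. radial_weight c y n)"
      by (rule sum.reindex_bij_witness[of _ Suc "\<lambda>n. n - 1"]) auto
    also have "\<dots> \<le> (\<Sum>n=1..k. radial_weight c y n)"
    proof (intro sum_mono2)
      fix n assume "n \<in> {1..k} - {1..k - 1}"
      then have "n \<le> k" by auto
      then have "t n \<le> 1" using t_mono tk order.trans by blast
      then show "0 \<le> radial_weight c y n" using g[of "t n"] t by (simp add: w)
    qed auto
    finally show ?thesis by simp
  qed (simp add: J0)
  then show ?thesis using upper J_end(2) unfolding J_def by (simp add: algebra_simps abs_le_iff)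
qed

lemma card_normsq_sphere_partial_sum:
  "(\<Sum>i=1..n. real (card {u. normsq u = i})) = real (card {u. normsq u \<le> n}) - 1"
proof (induction n)
  case 0
  have "{u. normsq u \<le> 0} = {0}" using normsq_eq_0_iff by auto
  then show ?case by simp
next
  case (Suc n)
  have "{u. normsq u \<le> Suc n} = {u. normsq u \<le> n} \<union> {u. normsq u = Suc n}" by auto
  moreover have "finite {u. normsq u = Suc n}"
    by (rule finite_subset[OF _ finite_normsq_le[of "Suc n"]]) auto
  ultimately have "card {u. normsq u \<le> Suc n} = card {u. normsq u \<le> n} + card {u. normsq u = Suc n}"
    using finite_normsq_le by (simp add: card_Un_disjoint disjoint_iff)
  then show ?case using Suc.IH by simp
qed

lemma sum_over_normsq:
  "(\<Sum>u | 0 < normsq u \<and> normsq u \<le> k. f (normsq u)) = (\<Sum>n=1..k. real (card {u. normsq u = n}) * f n)"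
proof -
  have fin: "finite {u. 0 < normsq u \<and> normsq u \<le> k}"
    by (rule finite_subset[OF _ finite_normsq_le[of k]]) auto
  have "(\<Sum>n=1..k. \<Sum>u\<in>{u\<in>{u. 0 < normsq u \<and> normsq u \<le> k}. normsq u = n}. f (normsq u))
      = (\<Sum>u | 0 < normsq u \<and> normsq u \<le> k. f (normsq u))"
    by (rule sum.group[OF fin]) auto
  moreover have "(\<Sum>u\<in>{u\<in>{u. 0 < normsq u \<and> normsq u \<le> k}. normsq u = n}. f (normsq u))
      = real (card {u. normsq u = n}) * f n" if "n \<in> {1..k}" for n
  proof -
    have "{u\<in>{u. 0 < normsq u \<and> normsq u \<le> k}. normsq u = n} = {u. normsq u = n}" using that by auto
    then show ?thesis by simp
  qed
  ultimately show ?thesis by (simp only: cong: sum.cong)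
qed

lemma ln_le_fourth_root:
  assumes "y > 0"
  shows "ln y \<le> 4 * sqrt (sqrt y)"
proof -
  have "ln (sqrt (sqrt y)) \<le> sqrt (sqrt y)"
    using assms by (intro order.trans[OF ln_le_minus_one]) auto
  then show ?thesis using assms by (simp add: ln_sqrt)
qed

text \<open>Split the number of vectors of squared norm n into pi and a fluctuation whose partial
  sums are O(sqrt n). The constant part is the preceding sum; the fluctuation contributes at most a
  multiple of \<open>harm k\<close>. This logarithm is relaxed to the fourth root of y, which is
  easy to sum over d later. The range y >= 1/2 leaves room for halving y.\<close>

lemma lattice_sum_radial_weight:
  "\<exists>K\<ge>0. \<forall>c y. 0 \<le> c \<longrightarrow> c \<le> 1 \<longrightarrow> 1 / 2 \<le> y \<longrightarrow>
     \<bar>(\<Sum>u | 0 < normsq u \<and> real (normsq u) < y. radial_weight c y (normsq u))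
        - 2 * pi * sqrt y * sqrt_integral c 1\<bar> \<le> K * sqrt (sqrt y)"
proof -
  define K where "K = 8 * pi + 1"
  have K: "K \<ge> 0" by (simp add: K_def)
  have "\<bar>(\<Sum>u | 0 < normsq u \<and> real (normsq u) < y. radial_weight c y (normsq u))
        - 2 * pi * sqrt y * sqrt_integral c 1\<bar> \<le> (K * 5 + 8 * pi) * sqrt (sqrt y)"
    if c: "0 \<le> c" "c \<le> 1" and y: "1 / 2 \<le> y" for c y
  proof -
    \<comment> \<open>The disc is given by a strict inequality, so an integer y must itself be
      excluded.\<close>
    define k where "k = nat (\<lceil>y\<rceil> - 1)"
    have k: "real k < y" "y \<le> real k + 1"
      using y unfolding k_def by linarith+
    have mem: "real n < y \<longleftrightarrow> n \<le> k" for n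
      using y unfolding k_def by linarith
    define e where "e n = real (card {u. normsq u = n}) - pi" for n
    define \<Phi> where "\<Phi> = radial_weight c y"
    have \<Phi>_arg: "0 \<le> 1 - c * real n / y" if "n \<le> k" for n
    proof -
      have "c * real n \<le> 1 * y" using c that k by (intro mult_mono) auto
      then show ?thesis using y by (simp add: field_simps)
    qed
    have \<Phi>: "0 \<le> \<Phi> n" "\<Phi> n \<le> 1 / sqrt n" if "n \<le> k" for n
      using \<Phi>_arg[OF that] c y unfolding \<Phi>_def radial_weight_def
      by (auto intro!: divide_right_mono)
    have E: "\<bar>\<Sum>i=1..n. e i\<bar> \<le> K * sqrt n" if "n \<ge> 1" for n
    proof -
      have "(\<Sum>i=1..n. e i) = real (card {u. normsq u \<le> n}) - pi * n - 1"
        unfolding e_def sum_subtractf card_normsq_sphere_partial_sum by simp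
      moreover have "1 \<le> sqrt n" using that by simp
      ultimately show ?thesis using lattice_points_in_disc[OF that]
        unfolding K_def abs_le_iff distrib_right by linarith
    qed
    have "\<bar>\<Sum>n=1..k. e n * \<Phi> n\<bar> \<le> K * (\<Sum>n=1..k. (sqrt n - sqrt (real n - 1)) * \<Phi> n)"
    proof (rule abel_sqrt_bound[OF E])
      fix n assume n: "1 \<le> n" "n < k"
      have "sqrt (1 - c * real (Suc n) / y) \<le> sqrt (1 - c * real n / y)"
        using c y by (auto intro!: divide_right_mono mult_left_mono)
      then show "\<Phi> (Suc n) \<le> \<Phi> n" unfolding \<Phi>_def radial_weight_def
        using n \<Phi>_arg[of n] by (intro frac_le) auto
    qed (use \<Phi> in auto)
    also have "(\<Sum>n=1..k. (sqrt n - sqrt (real n - 1)) * \<Phi> n) \<le> harm k"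
      unfolding harm_def
    proof (intro sum_mono)
      fix n assume n: "n \<in> {1..k}"
      have "(sqrt n - sqrt (real n - 1)) * \<Phi> n \<le> (1 / sqrt n) * (1 / sqrt n)"
        using n \<Phi>[of n] sqrt_diff_bounds(2)[of n] by (intro mult_mono) auto
      also have "\<dots> = inverse (real n)" by (simp add: field_simps)
      finally show "(sqrt n - sqrt (real n - 1)) * \<Phi> n \<le> inverse (real n)" .
    qed
    also have "harm k \<le> 5 * sqrt (sqrt y)"
    proof (cases "k = 0")
      case True
      then show ?thesis using y by (simp add: harm_def)
    next
      case False
      then have "harm k \<le> 1 + ln (real k)" by (intro harm_le_one_plus_ln) auto
      also have "\<dots> \<le> 1 + ln y" using False k by simp
      also have "\<dots> \<le> sqrt (sqrt y) + 4 * sqrt (sqrt y)"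
      proof (rule add_mono)
        have "1 \<le> y" using False k by simp
        then show "1 \<le> sqrt (sqrt y)" by simp
      qed (use ln_le_fourth_root y in auto)
      finally show ?thesis by simp
    qed
    finally have 1: "\<bar>\<Sum>n=1..k. e n * \<Phi> n\<bar> \<le> K * (5 * sqrt (sqrt y))" using K by (simp add: mult_left_mono)
    have "\<bar>pi * (\<Sum>n=1..k. \<Phi> n) - pi * (2 * sqrt y * sqrt_integral c 1)\<bar> \<le> pi * 4"
      using sum_radial_weight[OF c k] unfolding \<Phi>_def
      by (simp flip: right_diff_distrib add: abs_mult)
    also have "pi * 4 \<le> pi * (8 * sqrt (sqrt y))"
    proof -
      have "1 / 2 \<le> sqrt (sqrt y)"
        using y by (intro real_le_rsqrt) (auto simp: power2_eq_square)
      then show ?thesis by simp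
    qed
    finally have 2: "\<bar>pi * (\<Sum>n=1..k. \<Phi> n) - pi * (2 * sqrt y * sqrt_integral c 1)\<bar> \<le> pi * (8 * sqrt (sqrt y))" .
    have "(\<Sum>u | 0 < normsq u \<and> real (normsq u) < y. radial_weight c y (normsq u))
      = (\<Sum>n=1..k. e n * \<Phi> n + pi * \<Phi> n)"
      unfolding mem sum_over_normsq \<Phi>_def e_def by (intro sum.cong) (auto simp: algebra_simps)
    also have "\<dots> = (\<Sum>n=1..k. e n * \<Phi> n) + pi * (\<Sum>n=1..k. \<Phi> n)"
      by (simp add: sum.distrib sum_distrib_left)
    finally show ?thesis using 1 2 by (simp add: algebra_simps abs_le_iff)
  qed
  then show ?thesis using K by (intro exI[of _ "K * 5 + 8 * pi"]) auto
qed

section \<open>Lattice vectors of equal length with a given difference\<close>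

text \<open>With h = 2 k + g, the integer k ranges over a closed interval of length X.\<close>

lemma card_same_parity_interval:
  fixes g :: int and X :: real
  assumes "0 \<le> X"
  shows "finite {h::int. even (h - g) \<and> \<bar>real_of_int h\<bar> \<le> X}"
    and "\<bar>real (card {h::int. even (h - g) \<and> \<bar>real_of_int h\<bar> \<le> X}) - X\<bar> \<le> 1"
proof -
  let ?I = "{\<lceil>(- X - g) / 2\<rceil>..\<lfloor>(X - g) / 2\<rfloor>}"
  have eq: "{h::int. even (h - g) \<and> \<bar>real_of_int h\<bar> \<le> X} = (\<lambda>k. 2 * k + g) ` ?I"
  proof (intro equalityI subsetI)
    fix h assume "h \<in> {h::int. even (h - g) \<and> \<bar>real_of_int h\<bar> \<le> X}"
    moreover from this obtain k where "h - g = 2 * k" by (blast elim: evenE)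
    then have k: "h = 2 * k + g" by simp
    ultimately have "k \<in> ?I" by (auto simp: ceiling_le_iff le_floor_iff abs_le_iff field_simps)
    then show "h \<in> (\<lambda>k. 2 * k + g) ` ?I" using k by blast
  next
    fix h assume "h \<in> (\<lambda>k. 2 * k + g) ` ?I"
    then show "h \<in> {h::int. even (h - g) \<and> \<bar>real_of_int h\<bar> \<le> X}"
      by (auto simp: ceiling_le_iff le_floor_iff abs_le_iff field_simps)
  qed
  show "finite {h::int. even (h - g) \<and> \<bar>real_of_int h\<bar> \<le> X}" unfolding eq by simp
  define l m where "l = \<lceil>(- X - g) / 2\<rceil>" and "m = \<lfloor>(X - g) / 2\<rfloor>"
  have lm: "(- X - g) / 2 \<le> l" "l < (- X - g) / 2 + 1" "m \<le> (X - g) / 2" "(X - g) / 2 < real_of_int m + 1"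
    unfolding l_def m_def by linarith+
  \<comment> \<open>The formula m - l + 1 for the number of integers from l to m fails for negative
    values; here it is an integer above -1.\<close>
  then have "real_of_int m - real_of_int l + 1 > - 1" using assms by argo
  then have "m - l + 1 \<ge> 0" by linarith
  moreover have "card {h::int. even (h - g) \<and> \<bar>real_of_int h\<bar> \<le> X} = card ?I"
    unfolding eq by (intro card_image inj_onI) auto
  ultimately have "real (card {h::int. even (h - g) \<and> \<bar>real_of_int h\<bar> \<le> X}) = real_of_int m - real_of_int l + 1"
    unfolding l_def m_def by simp
  then show "\<bar>real (card {h::int. even (h - g) \<and> \<bar>real_of_int h\<bar> \<le> X}) - X\<bar> \<le> 1"
    using lm by argo
qed

text \<open>The points 0, w and w + u form a possibly degenerate isosceles triangle with base
  u.\<close>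

definition isosceles_partners :: "real \<Rightarrow> int \<times> int \<Rightarrow> (int \<times> int) set" where
  "isosceles_partners N u = {w. normsq (w + u) = normsq w \<and> real (normsq w) \<le> N}"

lemma normsq_add_eq_iff:
  "normsq (w + u) = normsq w \<longleftrightarrow>
     2 * (fst w * fst u + snd w * snd u) + (fst u)\<^sup>2 + (snd u)\<^sup>2 = 0"
proof -
  have "normsq (w + u) = normsq w \<longleftrightarrow> int (normsq (w + u)) = int (normsq w)" by simp
  also have "\<dots> \<longleftrightarrow> 2 * (fst w * fst u + snd w * snd u) + (fst u)\<^sup>2 + (snd u)\<^sup>2 = 0"
    unfolding int_normsq by (auto simp: power2_eq_square algebra_simps)
  finally show ?thesis .
qed

text \<open>Equal lengths mean 2 (w . u) + |u|^2 = 0, so |u|^2 is even; it has the parity of the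
  coordinate sum of u.\<close>

lemma isosceles_partners_odd:
  assumes "odd (fst u + snd u)"
  shows "isosceles_partners N u = {}"
proof -
  have "2 * (fst w * fst u + snd w * snd u) + (fst u)\<^sup>2 + (snd u)\<^sup>2 \<noteq> 0" for w
  proof
    assume "2 * (fst w * fst u + snd w * snd u) + (fst u)\<^sup>2 + (snd u)\<^sup>2 = 0"
    then have "even (2 * (fst w * fst u + snd w * snd u) + (fst u)\<^sup>2 + (snd u)\<^sup>2)" by simp
    with assms show False by simp
  qed
  then show ?thesis unfolding isosceles_partners_def normsq_add_eq_iff by blast
qed

definition gcd2 :: "int \<times> int \<Rightarrow> int" where
  "gcd2 u = gcd (fst u) (snd u)"

text \<open>Write \<open>u = g p\<close> with \<open>p\<close> primitive. The partners \<open>w\<close> of \<open>u\<close> are those for which \<open>2 w + u\<close> is orthogonal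
  to \<open>p\<close>, hence equal to \<open>h p\<^sup>\<bottom>\<close> for an integer \<open>h\<close>, and integrality of \<open>w\<close> means that \<open>h\<close> and \<open>g\<close>
  have the same parity.\<close>

lemma isosceles_partners_even:
  assumes even: "even (fst u + snd u)" and u: "normsq u > 0" and N: "real (normsq u) \<le> 4 * N"
  shows "finite (isosceles_partners N u)"
    and "\<bar>real (card (isosceles_partners N u))
           - real_of_int (gcd2 u) * sqrt (4 * N - normsq u) / sqrt (normsq u)\<bar> \<le> 1"
proof -
  define g where "g = gcd2 u"
  define a b where "a = fst u div g" and "b = snd u div g"
  have "u \<noteq> 0" using u normsq_eq_0_iff[of u] by auto
  then have g: "g > 0" unfolding g_def gcd2_def by (auto simp: prod_eq_iff)
  have ab: "fst u = g * a" "snd u = g * b" by (auto simp: a_def b_def g_def gcd2_def)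
  have "coprime a b"
    unfolding a_def b_def g_def gcd2_def using g by (intro div_gcd_coprime) (auto simp: g_def gcd2_def)
  then obtain p q where pq: "p * a + q * b = 1" using bezout_int[of a b] by auto
  have par: "even (g * (a + b))" using even by (simp add: ab algebra_simps)
  define Q where "Q = a\<^sup>2 + b\<^sup>2"
  have nu: "int (normsq u) = g\<^sup>2 * Q" by (simp add: int_normsq ab Q_def power_mult_distrib algebra_simps)
  then have rnu: "real (normsq u) = (real_of_int g)\<^sup>2 * real_of_int Q"
    by (metis of_int_mult of_int_of_nat_eq of_int_power)
  have Q: "Q > 0" using u nu g by (metis of_nat_0_less_iff zero_less_mult_pos zero_less_power)
  define X where "X = sqrt (4 * N - normsq u) / sqrt Q"
  have X: "X \<ge> 0" using N Q by (simp add: X_def)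
  have X2: "X\<^sup>2 = (4 * N - normsq u) / Q" using N Q by (simp add: X_def power_divide)
  define H where "H = {h::int. even (h - g) \<and> \<bar>real_of_int h\<bar> \<le> X}"
  \<comment> \<open>The solution w of 2 w + u = h (-b, a), where (a, b) is the primitive vector u /
    g.\<close>
  define W where "W h = ((- h * b - g * a) div 2, (h * a - g * b) div 2)" for h
  have W: "2 * fst (W h) = - h * b - g * a" "2 * snd (W h) = h * a - g * b" if "even (h - g)" for h
  proof -
    \<comment> \<open>As h and g have equal parity, both numbers are congruent to g (a + b) modulo
      2.\<close>
    have "even (- h * b - g * a)" "even (h * a - g * b)" using that par by auto
    then show "2 * fst (W h) = - h * b - g * a" "2 * snd (W h) = h * a - g * b" unfolding W_def by auto
  qed
  \<comment> \<open>Pythagoras: 2 w is the sum of the orthogonal vectors h (-b, a) and -u, so 4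
    |w|^2 = h^2 Q + |u|^2.\<close>
  have size: "\<bar>real_of_int h\<bar> \<le> X \<longleftrightarrow> real (normsq w) \<le> N"
    if "2 * fst w = - h * b - g * a" "2 * snd w = h * a - g * b" for h w
  proof -
    have "4 * int (normsq w) = (2 * fst w)\<^sup>2 + (2 * snd w)\<^sup>2"
      by (simp add: int_normsq power2_eq_square)
    also have "\<dots> = (h\<^sup>2 + g\<^sup>2) * Q" unfolding that Q_def by (simp add: power2_eq_square algebra_simps)
    finally have "real_of_int (4 * int (normsq w)) = real_of_int ((h\<^sup>2 + g\<^sup>2) * Q)" by (rule arg_cong)
    then have "4 * real (normsq w) = ((real_of_int h)\<^sup>2 + (real_of_int g)\<^sup>2) * real_of_int Q" by simp
    then have eq: "4 * real (normsq w) = (real_of_int h)\<^sup>2 * Q + normsq u"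
      by (simp add: rnu algebra_simps)
    have "\<bar>real_of_int h\<bar> \<le> X \<longleftrightarrow> (real_of_int h)\<^sup>2 \<le> X\<^sup>2"
      using X by (simp add: abs_le_square_iff[symmetric])
    also have "\<dots> \<longleftrightarrow> (real_of_int h)\<^sup>2 * Q \<le> 4 * N - normsq u"
      unfolding X2 using Q by (simp add: field_simps)
    also have "\<dots> \<longleftrightarrow> real (normsq w) \<le> N" using eq by linarith
    finally show ?thesis .
  qed
  have bij: "bij_betw W H (isosceles_partners N u)"
  proof (rule bij_betwI')
    fix h k assume "h \<in> H" "k \<in> H"
    then have e: "even (h - g)" "even (k - g)" by (auto simp: H_def)
    have "h = k" if "W h = W k"
    proof -
      have 0: "(h - k) * b = 0" "(h - k) * a = 0"
        using W[OF e(1)] W[OF e(2)] that by (auto simp: algebra_simps)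
      have "(h - k) * (p * a + q * b) = p * ((h - k) * a) + q * ((h - k) * b)"
        by (simp add: algebra_simps)
      also have "\<dots> = 0" by (simp only: 0 mult_zero_right add_0)
      finally show ?thesis by (simp add: pq)
    qed
    then show "(W h = W k) = (h = k)" by blast
  next
    fix h assume h: "h \<in> H"
    then have e: "even (h - g)" by (auto simp: H_def)
    have "2 * (2 * (fst (W h) * fst u + snd (W h) * snd u) + (fst u)\<^sup>2 + (snd u)\<^sup>2)
        = 2 * ((2 * fst (W h)) * (g * a) + (2 * snd (W h)) * (g * b) + (g * a)\<^sup>2 + (g * b)\<^sup>2)"
      by (simp add: ab algebra_simps)
    also have "\<dots> = 0" unfolding W[OF e] by (simp add: algebra_simps power2_eq_square)
    finally have "normsq (W h + u) = normsq (W h)" unfolding normsq_add_eq_iff by simp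
    moreover have "real (normsq (W h)) \<le> N" using size[OF W[OF e]] h by (simp add: H_def)
    ultimately show "W h \<in> isosceles_partners N u" by (simp add: isosceles_partners_def)
  next
    fix w assume w: "w \<in> isosceles_partners N u"
    define s t where "s = 2 * fst w + g * a" and "t = 2 * snd w + g * b"
    \<comment> \<open>(s, t) = 2 w + u is orthogonal to (a, b); the Bezout coefficients p, q recover
      the integer h with (s, t) = h (-b, a).\<close>
    define h where "h = t * p - s * q"
    have "g * (s * a + t * b) = 0"
      using w unfolding isosceles_partners_def normsq_add_eq_iff s_def t_def
      by (simp add: ab algebra_simps power2_eq_square)
    then have orth: "s * a + t * b = 0" using g by simp
    have "h * a = t * (p * a + q * b) - q * (s * a + t * b)" by (simp add: h_def algebra_simps)
    then have ha: "h * a = t" by (simp add: pq orth)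
    have "h * b = p * (s * a + t * b) - s * (p * a + q * b)" by (simp add: h_def algebra_simps)
    then have hb: "h * b = - s" by (simp add: pq orth)
    have w2: "2 * fst w = - h * b - g * a" "2 * snd w = h * a - g * b"
      using ha hb by (auto simp: s_def t_def)
    have "even (- h * b - g * a)" "even (h * a - g * b)" unfolding w2[symmetric] by auto
    \<comment> \<open>If a is odd, then h a, g b and g a agree modulo 2, hence so do h and g;
      likewise if b is odd.\<close>
    moreover have "odd a \<or> odd b"
    proof (rule ccontr)
      assume "\<not> (odd a \<or> odd b)"
      then have "even (p * a + q * b)" by simp
      then show False unfolding pq by simp
    qed
    ultimately have e: "even (h - g)" using par by auto
    moreover have "\<bar>real_of_int h\<bar> \<le> X" using size[OF w2] w by (simp add: isosceles_partners_def)
    ultimately have "h \<in> H" by (simp add: H_def)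
    moreover have "w = W h" using W[OF e] w2 by (simp add: prod_eq_iff)
    ultimately show "\<exists>h\<in>H. w = W h" by blast
  qed
  show "finite (isosceles_partners N u)"
    using bij_betw_finite[OF bij] card_same_parity_interval(1)[OF X] by (simp add: H_def)
  have "X = real_of_int (gcd2 u) * sqrt (4 * N - normsq u) / sqrt (normsq u)"
    using g Q unfolding X_def g_def[symmetric] by (subst (2) rnu) (simp add: real_sqrt_mult)
  then show "\<bar>real (card (isosceles_partners N u))
           - real_of_int (gcd2 u) * sqrt (4 * N - normsq u) / sqrt (normsq u)\<bar> \<le> 1"
    using bij_betw_same_card[OF bij] card_same_parity_interval(2)[OF X, of g] by (simp add: H_def)
qed

section \<open>Reduction of the count of pairs to a sum of gcds\<close>

lemma lattice_norm_sq: "(lattice_norm v)\<^sup>2 = real (normsq v)"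
  by (simp add: lattice_norm_def norm_lattice_point)

lemma lattice_norm_eq_sqrt: "lattice_norm v = sqrt (real (normsq v))"
  by (simp add: lattice_norm_def norm_lattice_point)

lemma lattice_norm_less_iff:
  assumes "M > 0"
  shows "lattice_norm v < M \<longleftrightarrow> real (normsq v) < M\<^sup>2"
  using assms real_sqrt_less_iff[of "real (normsq v)" "M\<^sup>2"] unfolding lattice_norm_eq_sqrt by simp

definition punctured_disc :: "real \<Rightarrow> (int \<times> int) set" where
  "punctured_disc y = {u. 0 < normsq u \<and> real (normsq u) < y}"

lemma finite_punctured_disc:
  assumes "0 \<le> r"
  shows "finite (punctured_disc (r\<^sup>2))"
  by (rule finite_subset[OF _ finite_normsq_le_square(1)[OF assms]]) (auto simp: punctured_disc_def)

lemma card_close_pairs: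
  assumes M: "0 < M" "M\<^sup>2 \<le> 4 * N"
  shows "card (close_pairs N M) = (\<Sum>u\<in>punctured_disc (M\<^sup>2). card (isosceles_partners N u))"
proof -
  have "close_pairs N M = (\<lambda>(u, w). (w + u, w)) ` (SIGMA u:punctured_disc (M\<^sup>2). isosceles_partners N u)"
  proof (intro equalityI subsetI)
    fix z assume "z \<in> close_pairs N M"
    then obtain v w where z: "z = (v, w)" and vw: "(v, w) \<in> close_pairs N M" by (cases z) auto
    have "(v - w, w) \<in> (SIGMA u:punctured_disc (M\<^sup>2). isosceles_partners N u)"
      using vw M unfolding close_pairs_def punctured_disc_def isosceles_partners_def
      by (auto simp: lattice_norm_sq lattice_norm_less_iff) (auto simp: lattice_norm_eq_sqrt)
    moreover have "z = (\<lambda>(u, w). (w + u, w)) (v - w, w)" by (simp add: z)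
    ultimately show "z \<in> (\<lambda>(u, w). (w + u, w)) ` (SIGMA u:punctured_disc (M\<^sup>2). isosceles_partners N u)"
      by (rule rev_image_eqI)
  next
    fix z assume "z \<in> (\<lambda>(u, w). (w + u, w)) ` (SIGMA u:punctured_disc (M\<^sup>2). isosceles_partners N u)"
    then obtain u w where "z = (w + u, w)" "u \<in> punctured_disc (M\<^sup>2)" "w \<in> isosceles_partners N u" by auto
    then show "z \<in> close_pairs N M"
      using M unfolding close_pairs_def punctured_disc_def isosceles_partners_def
      by (auto simp: lattice_norm_sq lattice_norm_less_iff) (auto simp: lattice_norm_eq_sqrt)
  qed
  then have "card (close_pairs N M) = card (SIGMA u:punctured_disc (M\<^sup>2). isosceles_partners N u)"
    by (simp only:) (intro card_image inj_onI, auto)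
  also have "\<dots> = (\<Sum>u\<in>punctured_disc (M\<^sup>2). card (isosceles_partners N u))"
  proof (rule card_SigmaI)
    show "finite (punctured_disc (M\<^sup>2))" using M finite_punctured_disc by simp
    show "\<forall>u\<in>punctured_disc (M\<^sup>2). finite (isosceles_partners N u)"
    proof
      fix u assume u: "u \<in> punctured_disc (M\<^sup>2)"
      show "finite (isosceles_partners N u)"
      proof (cases "even (fst u + snd u)")
        case True
        then show ?thesis using u M by (intro isosceles_partners_even) (auto simp: punctured_disc_def)
      next
        case False
        then show ?thesis by (simp add: isosceles_partners_odd)
      qed
    qed
  qed
  finally show ?thesis .
qed

definition even_punctured_disc :: "real \<Rightarrow> (int \<times> int) set" where
  "even_punctured_disc y = {u\<in>punctured_disc y. even (fst u + snd u)}"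

text \<open>Each even difference u contributes an error of at most 1, and a box count gives at most
  (2 M + 1)^2 <= 9 M^2 such u.\<close>

lemma card_close_pairs_gcd_sum:
  assumes M: "1 \<le> M" "M\<^sup>2 \<le> 4 * N"
  shows "\<bar>real (card (close_pairs N M))
      - (\<Sum>u\<in>even_punctured_disc (M\<^sup>2). real_of_int (gcd2 u) * (sqrt (4 * N - normsq u) / sqrt (normsq u)))\<bar>
    \<le> 9 * M\<^sup>2"
proof -
  let ?f = "\<lambda>u. real_of_int (gcd2 u) * (sqrt (4 * N - normsq u) / sqrt (normsq u))"
  let ?U = "punctured_disc (M\<^sup>2)" and ?E = "even_punctured_disc (M\<^sup>2)"
  have fin: "finite ?U" using M finite_punctured_disc by simp
  have sub: "?E \<subseteq> ?U" by (auto simp: even_punctured_disc_def)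
  have "real (card (close_pairs N M)) = (\<Sum>u\<in>?U. real (card (isosceles_partners N u)))"
    using M by (simp add: card_close_pairs)
  also have "\<dots> = (\<Sum>u\<in>?E. real (card (isosceles_partners N u)))"
    using fin sub by (intro sum.mono_neutral_right) (auto simp: even_punctured_disc_def isosceles_partners_odd)
  finally have "\<bar>real (card (close_pairs N M)) - (\<Sum>u\<in>?E. ?f u)\<bar>
      = \<bar>\<Sum>u\<in>?E. real (card (isosceles_partners N u)) - ?f u\<bar>" by (simp add: sum_subtractf)
  also have "\<dots> \<le> (\<Sum>u\<in>?E. \<bar>real (card (isosceles_partners N u)) - ?f u\<bar>)" by (rule sum_abs)
  also have "\<dots> \<le> (\<Sum>u\<in>?E. 1)"
  proof (intro sum_mono)
    fix u assume "u \<in> ?E"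
    then show "\<bar>real (card (isosceles_partners N u)) - ?f u\<bar> \<le> 1"
      using isosceles_partners_even(2)[of u N] M by (simp add: even_punctured_disc_def punctured_disc_def)
  qed
  also have "\<dots> = real (card ?E)" by simp
  also have "\<dots> \<le> real (card {u. real (normsq u) \<le> M\<^sup>2})"
    unfolding of_nat_le_iff using M
    by (intro card_mono finite_normsq_le_square(1)) (auto simp: even_punctured_disc_def punctured_disc_def)
  also have "\<dots> \<le> (2 * M + 1)\<^sup>2" using M by (intro finite_normsq_le_square(2)) auto
  also have "\<dots> \<le> (3 * M)\<^sup>2" using M by (intro power_mono) auto
  finally show ?thesis by (simp add: power_mult_distrib)
qed

section \<open>Summation over the differences\<close>

lemma gcd2_eq_sum_totient: "real_of_int (gcd2 u) = (\<Sum>d | d dvd nat (gcd2 u). real (totient d))"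
proof -
  have "real (nat (gcd2 u)) = (\<Sum>d | d dvd nat (gcd2 u). real (totient d))"
    by (subst (1) totient_divisor_sum[symmetric]) simp
  then show ?thesis by (simp add: gcd2_def)
qed

lemma dvd_gcd2_iff: "d dvd nat (gcd2 u) \<longleftrightarrow> int d dvd fst u \<and> int d dvd snd u"
proof -
  have "d dvd nat (gcd2 u) \<longleftrightarrow> int d dvd gcd2 u"
    by (metis gcd2_def gcd_ge_0_int int_dvd_int_iff nat_0_le)
  then show ?thesis by (simp add: gcd2_def)
qed

lemma normsq_scale: "normsq (int d * x, int d * y) = d\<^sup>2 * normsq (x, y)"
proof -
  have "int (normsq (int d * x, int d * y)) = int (d\<^sup>2 * normsq (x, y))"
    unfolding of_nat_mult int_normsq by (simp add: algebra_simps power_mult_distrib)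
  then show ?thesis by linarith
qed

text \<open>A nonzero vector d u' has length at least d. This truncates the divisor sums at M
  uniformly in u, so that the order of summation can be exchanged.\<close>

lemma divisor_le_of_mem_disc:
  assumes "d dvd nat (gcd2 u)" "u \<in> punctured_disc (M\<^sup>2)" "0 \<le> M"
  shows "d \<in> {1..nat \<lfloor>M\<rfloor>}"
proof -
  obtain x y where u: "u = (int d * x, int d * y)"
    using assms(1) unfolding dvd_gcd2_iff by (cases u) (auto elim!: dvdE)
  have n: "normsq u = d\<^sup>2 * normsq (x, y)" unfolding u by (rule normsq_scale)
  have "d \<noteq> 0" "normsq (x, y) \<noteq> 0" using assms(2) n by (auto simp: punctured_disc_def)
  then have "d\<^sup>2 * 1 \<le> normsq u" unfolding n by (intro mult_le_mono) auto
  then have "(real d)\<^sup>2 \<le> real (normsq u)" by (metis mult_1_right of_nat_le_iff of_nat_power)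
  then have "(real d)\<^sup>2 < M\<^sup>2"
    using assms(2) unfolding punctured_disc_def mem_Collect_eq by linarith
  then have "real d < M" using assms(3) by (rule power_less_imp_less_base)
  then show ?thesis using \<open>d \<noteq> 0\<close> by (auto simp: le_nat_floor)
qed

lemma gcd_sum_eq_totient_sum:
  assumes "0 \<le> M"
  shows "(\<Sum>u\<in>even_punctured_disc (M\<^sup>2). real_of_int (gcd2 u) * f u)
       = (\<Sum>d=1..nat \<lfloor>M\<rfloor>. real (totient d) *
            (\<Sum>u | u \<in> even_punctured_disc (M\<^sup>2) \<and> d dvd nat (gcd2 u). f u))"
proof -
  let ?E = "even_punctured_disc (M\<^sup>2)"
  have fin: "finite ?E"
    using finite_punctured_disc[OF assms] by (simp add: even_punctured_disc_def)
  have "(\<Sum>u\<in>?E. real_of_int (gcd2 u) * f u)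
      = (\<Sum>u\<in>?E. \<Sum>d | d \<in> {1..nat \<lfloor>M\<rfloor>} \<and> d dvd nat (gcd2 u). real (totient d) * f u)"
  proof (intro sum.cong refl)
    fix u assume "u \<in> ?E"
    then have "{d. d dvd nat (gcd2 u)} = {d. d \<in> {1..nat \<lfloor>M\<rfloor>} \<and> d dvd nat (gcd2 u)}"
      using divisor_le_of_mem_disc[OF _ _ assms, of _ u] unfolding even_punctured_disc_def by blast
    then show "real_of_int (gcd2 u) * f u
        = (\<Sum>d | d \<in> {1..nat \<lfloor>M\<rfloor>} \<and> d dvd nat (gcd2 u). real (totient d) * f u)"
      unfolding gcd2_eq_sum_totient sum_distrib_right by simp
  qed
  also have "\<dots> = (\<Sum>d=1..nat \<lfloor>M\<rfloor>. \<Sum>u | u \<in> ?E \<and> d dvd nat (gcd2 u). real (totient d) * f u)"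
    using fin by (intro sum.swap_restrict) auto
  finally show ?thesis by (simp add: sum_distrib_left)
qed

text \<open>Substitute u = d u'; the parity condition on u becomes evenness of d times the
  coordinate sum of u', which restricts u' only for odd d.\<close>

lemma dilated_sum:
  fixes N M :: real
  assumes d: "d \<ge> 1" and M: "0 < M" "M\<^sup>2 \<le> 4 * N"
  shows "(\<Sum>u | u \<in> even_punctured_disc (M\<^sup>2) \<and> d dvd nat (gcd2 u). sqrt (4 * N - normsq u) / sqrt (normsq u))
    = 2 * sqrt N / d * (\<Sum>u | u \<in> punctured_disc ((M / d)\<^sup>2) \<and> even (int d * (fst u + snd u)).
         radial_weight (M\<^sup>2 / (4 * N)) ((M / d)\<^sup>2) (normsq u))"
proof -
  have N: "N > 0" using M by (smt (verit) zero_less_power2)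
  let ?A = "{u. u \<in> punctured_disc ((M / d)\<^sup>2) \<and> even (int d * (fst u + snd u))}"
  let ?B = "{u. u \<in> even_punctured_disc (M\<^sup>2) \<and> d dvd nat (gcd2 u)}"
  have mem: "(int d * x, int d * y) \<in> punctured_disc (M\<^sup>2) \<longleftrightarrow> (x, y) \<in> punctured_disc ((M / d)\<^sup>2)" for x y
    using d unfolding punctured_disc_def mem_Collect_eq normsq_scale by (simp add: field_simps)
  have "(\<Sum>u\<in>?B. sqrt (4 * N - normsq u) / sqrt (normsq u))
      = (\<Sum>u\<in>?A. 2 * sqrt N / d * radial_weight (M\<^sup>2 / (4 * N)) ((M / d)\<^sup>2) (normsq u))"
  proof (rule sum.reindex_bij_witness[of _ "\<lambda>(x,y). (int d * x, int d * y)" "\<lambda>(x,y). (x div int d, y div int d)"])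
    fix u assume u: "u \<in> ?B"
    then obtain x y where xy: "u = (int d * x, int d * y)"
      unfolding dvd_gcd2_iff by (cases u) (auto elim!: dvdE)
    show "(case case u of (x, y) \<Rightarrow> (x div int d, y div int d) of (x, y) \<Rightarrow> (int d * x, int d * y)) = u"
      using d by (simp add: xy)
    show "(case u of (x, y) \<Rightarrow> (x div int d, y div int d)) \<in> ?A"
      using u d mem[of x y] by (auto simp: xy even_punctured_disc_def)
    have "sqrt (4 * N - real (normsq u)) = sqrt (4 * N * (1 - M\<^sup>2 / (4 * N) * normsq (x, y) / (M / d)\<^sup>2))"
      using N M d unfolding xy normsq_scale by (simp add: field_simps)
    also have "\<dots> = 2 * sqrt N * sqrt (1 - M\<^sup>2 / (4 * N) * normsq (x, y) / (M / d)\<^sup>2)"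
      by (simp only: real_sqrt_mult real_sqrt_four)
    finally show "2 * sqrt N / d * radial_weight (M\<^sup>2 / (4 * N)) ((M / d)\<^sup>2)
        (normsq (case u of (x, y) \<Rightarrow> (x div int d, y div int d)))
      = sqrt (4 * N - real (normsq u)) / sqrt (real (normsq u))"
      using d unfolding radial_weight_def by (simp add: xy normsq_scale real_sqrt_mult)
  next
    fix u assume u: "u \<in> ?A"
    obtain x y where xy: "u = (x, y)" by (cases u)
    show "(case case u of (x, y) \<Rightarrow> (int d * x, int d * y) of (x, y) \<Rightarrow> (x div int d, y div int d)) = u"
      using d by (simp add: xy)
    show "(case u of (x, y) \<Rightarrow> (int d * x, int d * y)) \<in> ?B"
      using u mem[of x y] unfolding dvd_gcd2_iff by (auto simp: xy even_punctured_disc_def algebra_simps)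
  qed
  then show ?thesis by (simp add: sum_distrib_left)
qed

text \<open>Multiplication by 1 + i, that is (p, q) -> (p - q, p + q), maps
  \<open>\<int>\<^sup>2\<close> bijectively onto the vectors with even coordinate sum and doubles
  the squared norm. Halving y keeps c n / y fixed, and 1 / sqrt n supplies the factor 1 / sqrt
  2.\<close>

lemma checkerboard_sum:
  assumes "y > 0"
  shows "(\<Sum>u | u \<in> punctured_disc y \<and> even (fst u + snd u). radial_weight c y (normsq u))
    = (\<Sum>u\<in>punctured_disc (y / 2). radial_weight c (y / 2) (normsq u)) / sqrt 2"
proof -
  have n: "normsq (p - q, p + q) = 2 * normsq (p, q)" for p q
  proof -
    have "int (normsq (p - q, p + q)) = int (2 * normsq (p, q))"
      unfolding of_nat_mult int_normsq by (simp add: algebra_simps power2_eq_square)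
    then show ?thesis by linarith
  qed
  have "(\<Sum>u | u \<in> punctured_disc y \<and> even (fst u + snd u). radial_weight c y (normsq u))
     = (\<Sum>u\<in>punctured_disc (y / 2). radial_weight c (y / 2) (normsq u) / sqrt 2)"
  proof (rule sum.reindex_bij_witness[of _ "\<lambda>(p,q). (p - q, p + q)" "\<lambda>(a,b). ((a + b) div 2, (b - a) div 2)"])
    fix u assume u: "u \<in> {u. u \<in> punctured_disc y \<and> even (fst u + snd u)}"
    define p q where "p = (fst u + snd u) div 2" and "q = (snd u - fst u) div 2"
    have "even (fst u + snd u)" "even (snd u - fst u)" using u by auto
    then have "2 * p = fst u + snd u" "2 * q = snd u - fst u" by (auto simp: p_def q_def)
    then have xy: "u = (p - q, p + q)" by (simp add: prod_eq_iff)
    show "(case case u of (a, b) \<Rightarrow> ((a + b) div 2, (b - a) div 2) of (p, q) \<Rightarrow> (p - q, p + q)) = u"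
      by (simp add: xy)
    show "(case u of (a, b) \<Rightarrow> ((a + b) div 2, (b - a) div 2)) \<in> punctured_disc (y / 2)"
      using u unfolding xy by (simp add: punctured_disc_def n)
    show "radial_weight c (y / 2) (normsq (case u of (a, b) \<Rightarrow> ((a + b) div 2, (b - a) div 2))) / sqrt 2
       = radial_weight c y (normsq u)"
      unfolding xy by (simp add: radial_weight_def n real_sqrt_mult algebra_simps)
  next
    fix u assume u: "u \<in> punctured_disc (y / 2)"
    obtain p q where xy: "u = (p, q)" by (cases u)
    show "(case case u of (p, q) \<Rightarrow> (p - q, p + q) of (a, b) \<Rightarrow> ((a + b) div 2, (b - a) div 2)) = u"
      by (simp add: xy)
    show "(case u of (p, q) \<Rightarrow> (p - q, p + q)) \<in> {u. u \<in> punctured_disc y \<and> even (fst u + snd u)}"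
      using u unfolding xy by (simp add: punctured_disc_def n)
  qed
  then show ?thesis by (simp add: sum_divide_distrib)
qed

text \<open>For odd d the main term is taken at y / 2 and divided by sqrt 2; sqrt (y / 2) / sqrt 2 =
  sqrt y / 2 yields the weight 1/2. From y >= 1 follows y / 2 >= 1/2.\<close>

lemma parity_restricted_radial_sum:
  "\<exists>K\<ge>0. \<forall>c y d. 0 \<le> c \<longrightarrow> c \<le> 1 \<longrightarrow> 1 \<le> y \<longrightarrow>
     \<bar>(\<Sum>u | u \<in> punctured_disc y \<and> even (int d * (fst u + snd u)). radial_weight c y (normsq u))
        - parity_weight d * (2 * pi * sqrt y * sqrt_integral c 1)\<bar> \<le> K * sqrt (sqrt y)"
proof -
  obtain K where K: "K \<ge> 0" and bound: "\<And>c y. 0 \<le> c \<Longrightarrow> c \<le> 1 \<Longrightarrow> 1 / 2 \<le> y \<Longrightarrow>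
     \<bar>(\<Sum>u\<in>punctured_disc y. radial_weight c y (normsq u))
        - 2 * pi * sqrt y * sqrt_integral c 1\<bar> \<le> K * sqrt (sqrt y)"
    using lattice_sum_radial_weight unfolding punctured_disc_def by blast
  have "\<bar>(\<Sum>u | u \<in> punctured_disc y \<and> even (int d * (fst u + snd u)). radial_weight c y (normsq u))
        - parity_weight d * (2 * pi * sqrt y * sqrt_integral c 1)\<bar> \<le> K * sqrt (sqrt y)"
    if c: "0 \<le> c" "c \<le> 1" and y: "1 \<le> y" for c y and d :: nat
  proof (cases "even d")
    case True
    then show ?thesis using bound[OF c, of y] y by (simp add: parity_weight_def)
  next
    case False
    let ?S = "\<Sum>u\<in>punctured_disc (y / 2). radial_weight c (y / 2) (normsq u)"
    have S: "(\<Sum>u | u \<in> punctured_disc y \<and> even (int d * (fst u + snd u)). radial_weight c y (normsq u))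
      = ?S / sqrt 2"
      using False y checkerboard_sum[of y c] by simp
    have "parity_weight d * (2 * pi * sqrt y * sqrt_integral c 1)
      = (2 * pi * sqrt (y / 2) * sqrt_integral c 1) / sqrt 2"
      using False by (simp add: parity_weight_def real_sqrt_divide)
    then have "\<bar>?S / sqrt 2 - parity_weight d * (2 * pi * sqrt y * sqrt_integral c 1)\<bar>
      = \<bar>?S - 2 * pi * sqrt (y / 2) * sqrt_integral c 1\<bar> / sqrt 2"
      by (simp flip: diff_divide_distrib add: abs_divide)
    also have "\<dots> \<le> \<bar>?S - 2 * pi * sqrt (y / 2) * sqrt_integral c 1\<bar> / 1"
      by (intro divide_left_mono) auto
    also have "\<dots> \<le> K * sqrt (sqrt (y / 2))" using bound[OF c, of "y / 2"] y by simp
    also have "\<dots> \<le> K * sqrt (sqrt y)" using K y by (intro mult_left_mono) auto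
    finally show ?thesis unfolding S .
  qed
  then show ?thesis using K by blast
qed

text \<open>On [0, 1/2] the integrand is at least sqrt (3/4) >= 3/4. A positive lower bound uniform
  in c is what the passage to relative errors needs.\<close>

lemma sqrt_integral_1_bounds:
  assumes "0 \<le> c" "c \<le> 1"
  shows "3 / 8 \<le> sqrt_integral c 1" "sqrt_integral c 1 \<le> 1"
proof -
  have "sqrt (1 - c * 1\<^sup>2) * (1 - 1 / 2) \<le> sqrt_integral c 1 - sqrt_integral c (1 / 2)"
    using assms by (intro sqrt_integral_diff_bounds) auto
  moreover have "0 \<le> sqrt (1 - c * 1\<^sup>2) * (1 - 1 / 2)" using assms by simp
  ultimately have "0 \<le> sqrt_integral c 1 - sqrt_integral c (1 / 2)" by (rule order.trans[rotated])
  moreover have "sqrt (1 - c * (1 / 2)\<^sup>2) / 2 \<le> sqrt_integral c (1 / 2)"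
    using sqrt_integral_diff_bounds(1)[of c 0 "1 / 2"] assms by (simp add: sqrt_integral_0)
  moreover have "3 / 4 \<le> sqrt (1 - c * (1 / 2)\<^sup>2)"
    using assms by (intro real_le_rsqrt) (simp add: power2_eq_square)
  ultimately show "3 / 8 \<le> sqrt_integral c 1" by linarith
  show "sqrt_integral c 1 \<le> 1"
    using sqrt_integral_diff_bounds(2)[of c 0 1] assms by (simp add: sqrt_integral_0)
qed

lemma sum_inverse_sqrt_le: "(\<Sum>d=1..m. 1 / sqrt (real d)) \<le> 2 * sqrt m"
proof (induction m)
  case (Suc m)
  then show ?case using sqrt_diff_bounds(1)[of "Suc m"] by simp
qed simp

lemma weighted_totient_sum_floor:
  "\<exists>B\<ge>0. \<forall>M\<ge>1. \<bar>weighted_totient_sum (nat \<lfloor>M\<rfloor>) - 4 / pi\<^sup>2 * ln M\<bar> \<le> B"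
proof -
  obtain B where B: "\<And>n. n \<ge> 1 \<Longrightarrow> \<bar>weighted_totient_sum n - 4 / pi\<^sup>2 * ln (real n)\<bar> \<le> B"
    using weighted_totient_sum_asymptotics by blast
  have "\<bar>weighted_totient_sum (nat \<lfloor>M\<rfloor>) - 4 / pi\<^sup>2 * ln M\<bar> \<le> B + 4 / pi\<^sup>2" if M: "M \<ge> 1" for M
  proof -
    define n where "n = nat \<lfloor>M\<rfloor>"
    have n1: "n \<ge> 1" "real n \<le> M" "M < real n + 1" using M unfolding n_def by linarith+
    then have n: "n \<ge> 1" "real n \<le> M" "M \<le> 2 * real n" by linarith+
    have "ln (real n) \<le> ln M" using n by simp
    moreover have "ln M \<le> ln (2 * real n)" using n M by simp
    then have "ln M \<le> ln (real n) + 1" using n ln_2_less_1 by (simp add: ln_mult)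
    ultimately have "\<bar>ln (real n) - ln M\<bar> \<le> 1" by simp
    then have "\<bar>4 / pi\<^sup>2 * ln (real n) - 4 / pi\<^sup>2 * ln M\<bar> \<le> 4 / pi\<^sup>2 * 1"
      unfolding right_diff_distrib[symmetric] abs_mult by (intro mult_mono) auto
    then show ?thesis using B[OF n(1)] unfolding n_def by linarith
  qed
  moreover from this[of 1] have "B + 4 / pi\<^sup>2 \<ge> 0" by linarith
  ultimately show ?thesis by blast
qed

text \<open>For d <= M the radius M / d is at least 1, so the radial estimate has error K sqrt (M /
  d). Its coefficient phi(d) 2 sqrt N / d is at most 2 sqrt N, and the sum of d^(-1/2) over d <= M
  is at most 2 sqrt M, which gives the total 4 K sqrt N M.\<close>

lemma gcd_sum_asymptotics:
  "\<exists>K\<ge>0. \<forall>(N::real) (M::real). 1 \<le> M \<longrightarrow> M\<^sup>2 \<le> 4 * N \<longrightarrow>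
     \<bar>(\<Sum>u\<in>even_punctured_disc (M\<^sup>2). real_of_int (gcd2 u) * (sqrt (4 * N - normsq u) / sqrt (normsq u)))
        - 4 * pi * sqrt N * M * sqrt_integral (M\<^sup>2 / (4 * N)) 1 * weighted_totient_sum (nat \<lfloor>M\<rfloor>)\<bar>
      \<le> K * (sqrt N * M)"
proof -
  obtain K where K: "K \<ge> 0" and bound: "\<And>c y d. 0 \<le> c \<Longrightarrow> c \<le> 1 \<Longrightarrow> 1 \<le> y \<Longrightarrow>
     \<bar>(\<Sum>u | u \<in> punctured_disc y \<and> even (int d * (fst u + snd u)). radial_weight c y (normsq u))
        - parity_weight d * (2 * pi * sqrt y * sqrt_integral c 1)\<bar> \<le> K * sqrt (sqrt y)"
    using parity_restricted_radial_sum by blast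
  have "\<bar>(\<Sum>u\<in>even_punctured_disc (M\<^sup>2). real_of_int (gcd2 u) * (sqrt (4 * N - normsq u) / sqrt (normsq u)))
        - 4 * pi * sqrt N * M * sqrt_integral (M\<^sup>2 / (4 * N)) 1 * weighted_totient_sum (nat \<lfloor>M\<rfloor>)\<bar>
      \<le> (4 * K) * (sqrt N * M)" if M: "1 \<le> M" "M\<^sup>2 \<le> 4 * N" for N M :: real
  proof -
    have N: "N > 0" using M by (smt (verit) zero_less_power2)
    define c where "c = M\<^sup>2 / (4 * N)"
    have c: "0 \<le> c" "c \<le> 1" using M N by (auto simp: c_def)
    define m where "m = nat \<lfloor>M\<rfloor>"
    define T where "T d = (\<Sum>u | u \<in> punctured_disc ((M / real d)\<^sup>2) \<and> even (int d * (fst u + snd u)).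
         radial_weight c ((M / d)\<^sup>2) (normsq u))" for d :: nat
    define R where "R d = parity_weight d * (2 * pi * (M / d) * sqrt_integral c 1)" for d :: nat
    have m: "real m \<le> M" using M by (simp add: m_def)
    have TR: "\<bar>T d - R d\<bar> \<le> K * sqrt (M / d)" if "d \<in> {1..m}" for d
    proof -
      have "1 \<le> M / d" using that m by auto
      then show ?thesis using bound[OF c, of "(M / d)\<^sup>2" d] M unfolding T_def R_def by simp
    qed
    have "(\<Sum>u\<in>even_punctured_disc (M\<^sup>2). real_of_int (gcd2 u) * (sqrt (4 * N - normsq u) / sqrt (normsq u)))
      = (\<Sum>d=1..m. real (totient d) * (2 * sqrt N / d * T d))"
      unfolding m_def using M
      by (subst gcd_sum_eq_totient_sum, simp, intro sum.cong refl, subst dilated_sum)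
        (auto simp: T_def c_def)
    moreover have "4 * pi * sqrt N * M * sqrt_integral c 1 * weighted_totient_sum m
      = (\<Sum>d=1..m. real (totient d) * (2 * sqrt N / d * R d))"
      unfolding weighted_totient_sum_def sum_distrib_left R_def
      by (intro sum.cong) (auto simp: power2_eq_square field_simps)
    ultimately have "(\<Sum>u\<in>even_punctured_disc (M\<^sup>2). real_of_int (gcd2 u) * (sqrt (4 * N - normsq u) / sqrt (normsq u)))
        - 4 * pi * sqrt N * M * sqrt_integral c 1 * weighted_totient_sum m
       = (\<Sum>d=1..m. real (totient d) * (2 * sqrt N / d) * (T d - R d))"
      by (simp only: sum_subtractf[symmetric] mult.assoc right_diff_distrib)
    also have "\<bar>\<dots>\<bar> \<le> (\<Sum>d=1..m. \<bar>real (totient d) * (2 * sqrt N / d) * (T d - R d)\<bar>)"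
      by (rule sum_abs)
    also have "\<dots> \<le> (\<Sum>d=1..m. 2 * sqrt N * (K * sqrt M) * (1 / sqrt d))"
    proof (intro sum_mono)
      fix d assume d: "d \<in> {1..m}"
      have "real (totient d) * (2 * sqrt N / d) \<le> real d * (2 * sqrt N / d)"
        using N by (intro mult_right_mono) (auto simp: totient_le)
      also have "\<dots> = 2 * sqrt N" using d by simp
      finally have 1: "real (totient d) * (2 * sqrt N / d) \<le> 2 * sqrt N" .
      have "\<bar>real (totient d) * (2 * sqrt N / d) * (T d - R d)\<bar>
          = real (totient d) * (2 * sqrt N / d) * \<bar>T d - R d\<bar>"
        using N by (simp add: abs_mult)
      also have "\<dots> \<le> 2 * sqrt N * (K * sqrt (M / d))"
        by (rule mult_mono[OF 1 TR[OF d]]) (use N in auto)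
      finally show "\<bar>real (totient d) * (2 * sqrt N / d) * (T d - R d)\<bar>
          \<le> 2 * sqrt N * (K * sqrt M) * (1 / sqrt d)" by (simp add: real_sqrt_divide)
    qed
    also have "\<dots> = 2 * sqrt N * (K * sqrt M) * (\<Sum>d=1..m. 1 / sqrt d)" by (simp only: sum_distrib_left)
    also have "\<dots> \<le> 2 * sqrt N * (K * sqrt M) * (2 * sqrt M)"
    proof (intro mult_left_mono)
      show "(\<Sum>d=1..m. 1 / sqrt d) \<le> 2 * sqrt M"
        using sum_inverse_sqrt_le[of m] m real_sqrt_le_mono[OF m] by linarith
    qed (use N K M in auto)
    also have "\<dots> = (4 * K) * (sqrt N * M)" using M by simp
    finally show ?thesis unfolding c_def m_def .
  qed
  then show ?thesis using K by (intro exI[of _ "4 * K"]) auto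
qed

section \<open>The main term and the relative error\<close>

lemma card_close_pairs_main_term:
  "\<exists>C>0. \<forall>N M. 1 < M \<longrightarrow> 0 \<le> N \<longrightarrow> M \<le> 2 * sqrt N \<longrightarrow>
     \<bar>real (card (close_pairs N M)) - main_term N M\<bar> \<le> C * (sqrt N * M)"
proof -
  obtain K where K: "K \<ge> 0" and bound: "\<And>(N::real) (M::real). 1 \<le> M \<Longrightarrow> M\<^sup>2 \<le> 4 * N \<Longrightarrow>
     \<bar>(\<Sum>u\<in>even_punctured_disc (M\<^sup>2). real_of_int (gcd2 u) * (sqrt (4 * N - normsq u) / sqrt (normsq u)))
        - 4 * pi * sqrt N * M * sqrt_integral (M\<^sup>2 / (4 * N)) 1 * weighted_totient_sum (nat \<lfloor>M\<rfloor>)\<bar>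
      \<le> K * (sqrt N * M)"
    using gcd_sum_asymptotics by blast
  obtain B where B: "B \<ge> 0" and totient: "\<And>M. M \<ge> 1 \<Longrightarrow>
      \<bar>weighted_totient_sum (nat \<lfloor>M\<rfloor>) - 4 / pi\<^sup>2 * ln M\<bar> \<le> B"
    using weighted_totient_sum_floor by blast
  \<comment> \<open>The 18 comes from 9 M^2 with M <= 2 sqrt N, K from the gcd sum, and 4 pi B from
    replacing the weighted totient sum by its logarithm.\<close>
  have "\<bar>real (card (close_pairs N M)) - main_term N M\<bar> \<le> (18 + K + 4 * pi * B) * (sqrt N * M)"
    if M: "1 < M" "0 \<le> N" "M \<le> 2 * sqrt N" for N M
  proof -
    have "M\<^sup>2 \<le> (2 * sqrt N)\<^sup>2" using M by (intro power_mono) auto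
    then have M2: "M\<^sup>2 \<le> 4 * N" using M by (simp add: power_mult_distrib)
    have N: "N > 0" using M M2 by (smt (verit) zero_less_power2)
    define c where "c = M\<^sup>2 / (4 * N)"
    have c: "0 \<le> c" "c \<le> 1" using M2 N by (auto simp: c_def)
    define P where "P = 4 * pi * sqrt N * M * sqrt_integral c 1"
    have P: "0 \<le> P" "P \<le> 4 * pi * (sqrt N * M)"
    proof -
      show "0 \<le> P" unfolding P_def using sqrt_integral_1_bounds[OF c] M N by simp
      have "P \<le> 4 * pi * sqrt N * M * 1"
        unfolding P_def using sqrt_integral_1_bounds[OF c] M N by (intro mult_left_mono) auto
      then show "P \<le> 4 * pi * (sqrt N * M)" by (simp add: mult.assoc)
    qed
    \<comment> \<open>The constants agree: 4 pi (4 / pi^2) = 4 (4 / pi), and 4 / pi is the factor in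
      \<open>I_fun\<close>.\<close>
    have main: "main_term N M = P * (4 / pi\<^sup>2 * ln M)"
      unfolding main_term_def I_fun_def P_def sqrt_integral_def c_def by (simp add: power2_eq_square)
    have "\<bar>P * weighted_totient_sum (nat \<lfloor>M\<rfloor>) - main_term N M\<bar> \<le> P * B"
      unfolding main right_diff_distrib[symmetric] abs_mult using P totient[of M] M
      by (intro mult_mono) auto
    also have "\<dots> \<le> 4 * pi * (sqrt N * M) * B" using P B by (intro mult_right_mono) auto
    finally have 1: "\<bar>P * weighted_totient_sum (nat \<lfloor>M\<rfloor>) - main_term N M\<bar> \<le> 4 * pi * (sqrt N * M) * B" .
    have "9 * M\<^sup>2 \<le> 18 * (sqrt N * M)"
      using mult_right_mono[OF M(3), of M] M by (simp add: power2_eq_square)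
    with 1 card_close_pairs_gcd_sum[of M N] bound[of M N] M M2
    have "\<bar>real (card (close_pairs N M)) - main_term N M\<bar>
        \<le> 18 * (sqrt N * M) + K * (sqrt N * M) + 4 * pi * (sqrt N * M) * B"
      unfolding P_def c_def by linarith
    also have "\<dots> = (18 + K + 4 * pi * B) * (sqrt N * M)" by (simp add: algebra_simps)
    finally show ?thesis .
  qed
  moreover have "18 + K + 4 * pi * B > 0" using K B by (simp add: add_pos_nonneg)
  ultimately show ?thesis by blast
qed

text \<open>Dividing the absolute error O(sqrt N M) by this lower bound gives the relative error O(1
  / ln M). The constant is 1 because (16 / pi) (3/8) = 6 / pi >= 1.\<close>

lemma main_term_ge:
  assumes "1 < M" "0 \<le> N" "M \<le> 2 * sqrt N"
  shows "main_term N M \<ge> sqrt N * M * ln M" "main_term N M > 0"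
proof -
  have "M\<^sup>2 \<le> (2 * sqrt N)\<^sup>2" using assms by (intro power_mono) auto
  then have M2: "M\<^sup>2 \<le> 4 * N" using assms by (simp add: power_mult_distrib)
  have N: "N > 0" using assms M2 by (smt (verit) zero_less_power2)
  have "3 / 8 \<le> sqrt_integral (M\<^sup>2 / (4 * N)) 1"
    using M2 N by (intro sqrt_integral_1_bounds) auto
  then have "16 / pi * (3 / 8) \<le> 16 / pi * sqrt_integral (M\<^sup>2 / (4 * N)) 1"
    by (intro mult_left_mono) auto
  moreover have "1 \<le> 16 / pi * (3 / 8)" using pi_less_4 by (simp add: field_simps)
  moreover have "4 * I_fun (M\<^sup>2 / (4 * N)) = 16 / pi * sqrt_integral (M\<^sup>2 / (4 * N)) 1"
    by (simp add: I_fun_def sqrt_integral_def)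
  ultimately have "1 \<le> 4 * I_fun (M\<^sup>2 / (4 * N))" by linarith
  then have "1 * (sqrt N * M * ln M) \<le> 4 * I_fun (M\<^sup>2 / (4 * N)) * (sqrt N * M * ln M)"
    using assms N by (intro mult_right_mono) auto
  then show *: "main_term N M \<ge> sqrt N * M * ln M" by (simp add: main_term_def mult.assoc)
  have "sqrt N * M * ln M > 0" using assms N by simp
  with * show "main_term N M > 0" by linarith
qed

lemma close_pairs_relative_error:
  "\<exists>C>0. \<forall>N M. 1 < M \<longrightarrow> 0 \<le> N \<longrightarrow> M \<le> 2 * sqrt N \<longrightarrow>
     \<bar>real (card (close_pairs N M)) / main_term N M - 1\<bar> \<le> C / ln M"
proof -
  obtain C where C: "C > 0" and bound: "\<And>N M. 1 < M \<Longrightarrow> 0 \<le> N \<Longrightarrow> M \<le> 2 * sqrt N \<Longrightarrow>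
     \<bar>real (card (close_pairs N M)) - main_term N M\<bar> \<le> C * (sqrt N * M)"
    using card_close_pairs_main_term by blast
  have "\<bar>real (card (close_pairs N M)) / main_term N M - 1\<bar> \<le> C / ln M"
    if M: "1 < M" "0 \<le> N" "M \<le> 2 * sqrt N" for N M
  proof -
    have pos: "main_term N M > 0" and ge: "main_term N M \<ge> sqrt N * M * ln M"
      using main_term_ge[OF M] by auto
    have ln: "ln M > 0" using M by simp
    have "real (card (close_pairs N M)) / main_term N M - 1
        = (real (card (close_pairs N M)) - main_term N M) / main_term N M"
      using pos by (simp add: diff_divide_distrib)
    then have "\<bar>real (card (close_pairs N M)) / main_term N M - 1\<bar>
        = \<bar>real (card (close_pairs N M)) - main_term N M\<bar> / main_term N M"
      using pos by (simp add: abs_divide)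
    also have "\<dots> \<le> C * (sqrt N * M) / main_term N M"
      using bound[OF M] pos by (simp add: divide_right_mono)
    also have "\<dots> \<le> C / ln M"
    proof -
      have "C * (sqrt N * M) * ln M \<le> C * main_term N M"
        using ge C by (simp add: mult.assoc)
      then show ?thesis using pos ln by (simp add: field_simps)
    qed
    finally show ?thesis .
  qed
  then show ?thesis using C by blast
qed

theorem theorem6p1:
  shows "(\<exists>C>0. \<exists>N0>0. \<forall>N\<ge>N0. \<forall>M::real. 1 < M \<and> M \<le> 2 * sqrt N \<longrightarrow>
            (\<exists>E. \<bar>E\<bar> \<le> C / ln M \<and>
                 real (card (close_pairs N M)) = main_term N M * (1 + E)))
       \<and> (\<forall>M :: real \<Rightarrow> real.
            (\<forall>\<^sub>F N in at_top. M N \<le> 2 * sqrt N) \<and> filterlim M at_top at_top \<longrightarrow>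
            (\<lambda>N. real (card (close_pairs N (M N)))) \<sim>[at_top] (\<lambda>N. main_term N (M N)))"
proof -
  obtain C where C: "C > 0" and bound: "\<And>N M. 1 < M \<Longrightarrow> 0 \<le> N \<Longrightarrow> M \<le> 2 * sqrt N \<Longrightarrow>
     \<bar>real (card (close_pairs N M)) / main_term N M - 1\<bar> \<le> C / ln M"
    using close_pairs_relative_error by blast
  show ?thesis
  proof (intro conjI allI impI)
    \<comment> \<open>The estimate is uniform in N, so the threshold 1 serves; E is the ratio of
      count and main term, minus 1.\<close>
    have "\<exists>E. \<bar>E\<bar> \<le> C / ln M \<and> real (card (close_pairs N M)) = main_term N M * (1 + E)"
      if "N \<ge> 1" "1 < M" "M \<le> 2 * sqrt N" for N M
      using bound[of M N] main_term_ge(2)[of M N] that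
      by (intro exI[of _ "real (card (close_pairs N M)) / main_term N M - 1"]) auto
    then show "\<exists>C>0. \<exists>N0>0. \<forall>N\<ge>N0. \<forall>M::real. 1 < M \<and> M \<le> 2 * sqrt N \<longrightarrow>
            (\<exists>E. \<bar>E\<bar> \<le> C / ln M \<and> real (card (close_pairs N M)) = main_term N M * (1 + E))"
      using C by (intro exI[of _ C] exI[of _ 1] conjI) auto
  next
    fix M :: "real \<Rightarrow> real"
    assume asm: "(\<forall>\<^sub>F N in at_top. M N \<le> 2 * sqrt N) \<and> filterlim M at_top at_top"
    then have M: "filterlim M at_top at_top" by blast
    have "((\<lambda>N. real (card (close_pairs N (M N))) / main_term N (M N) - 1) \<longlongrightarrow> 0) at_top"
    proof (rule Lim_null_comparison)
      have "\<forall>\<^sub>F N in at_top. 1 < M N" using M by (simp add: filterlim_at_top_dense)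
      moreover have "\<forall>\<^sub>F N in at_top. (0::real) \<le> N" by (rule eventually_ge_at_top)
      ultimately show "\<forall>\<^sub>F N in at_top.
          norm (real (card (close_pairs N (M N))) / main_term N (M N) - 1) \<le> C / ln (M N)"
        using asm[THEN conjunct1] by eventually_elim (use bound in auto)
      have "filterlim (\<lambda>N. ln (M N)) at_top at_top"
        using M by (rule filterlim_compose[OF ln_at_top])
      then show "((\<lambda>N. C / ln (M N)) \<longlongrightarrow> 0) at_top"
        by (intro tendsto_divide_0[OF tendsto_const] filterlim_at_top_imp_at_infinity)
    qed
    then have "((\<lambda>N. real (card (close_pairs N (M N))) / main_term N (M N)) \<longlongrightarrow> 1) at_top"
      by (simp add: LIM_zero_iff)
    then show "(\<lambda>N. real (card (close_pairs N (M N)))) \<sim>[at_top] (\<lambda>N. main_term N (M N))"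
      by (rule asymp_equivI')
  qed
qed

end
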